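(* Let $X$ be a Banach sequence space over $\mathbb{Z}$ in which $(e_n)_{n\in\mathbb{Z}}$ is an unconditional basis. Let $w=(w_n)_{n\in\mathbb{Z}}$ be a sequence of non-zero scalars such that the weighted backward shift $B_w$ is an operator on $X$, and define $v=(v_n)_{n\in\mathbb{Z}}$ by $$v_n=\frac{1}{w_1\cdots w_n}\ (n>0),\qquad v_0=1,\qquad v_n=w_{n+1}\cdots w_0\ (n<0).$$ Let $\mathcal{A}$ be an upper Furstenberg family. Then the following assertions are equivalent. (a) For some (equivalently, for all) sequences $(\varepsilon_p)_{p\geq1}$ of positive numbers tending to $0$ there is a sequence $(A_p)_{p\geq1}$ of pairwise disjoint sets in $\mathcal{A}$ such that, for any $p,q\geq1$, any $m\in A_q$, and any $j=-p,\ldots,p$, $$\Big|\Big|\Big|\sum_{n\in A_p,\ n\neq m} v_{n-m+j}\,e_{n-m+j}\Big|\Big|\Big|<\min(\varepsilon_p,\varepsilon_q).$$ (b) $B_w:\widehat{X}\to\widehat{X}$ is $\mathcal{A}$-hypercyclic for $X$. (c) $B_w:X\to X$ is $\mathcal{A}$-hypercyclic. If $B_w$ is invertible, then in (a) it suffices to require the displayed inequality for $j=0$ only.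
   Context: Scalars are real or complex ($\mathbb{K}=\mathbb{R}$ or $\mathbb{C}$). An operator on a Banach space is a continuous linear self-map. A Banach sequence space over $\mathbb{Z}$ is a Banach space $X$ that is a subspace of $\mathbb{K}^{\mathbb{Z}}$ such that each coordinate functional $(x_n)_{n\in\mathbb{Z}}\mapsto x_k$, $k\in\mathbb{Z}$, is continuous on $X$. The canonical unit sequences are $e_n=(\delta_{n,k})_{k\in\mathbb{Z}}$. That $(e_n)_{n\in\mathbb{Z}}$ is a basis of $X$ means that all $e_n$ lie in $X$ and every $x=(x_n)\in X$ satisfies $x=\lim_{m,n\to\infty}\sum_{-m\leq k\leq n}x_ke_k$ in $X$; it is unconditional if these series converge unconditionally. For any scalar sequence $x=(x_n)_{n\in\mathbb{Z}}$ put $|||x|||=\sup_{m,n\geq0}\big\|\sum_{-m\leq k\leq n}x_ke_k\big\|\in[0,\infty]$. On $X$ this is a norm equivalent to the original one. Let $\widehat{X}=\{x\in\mathbb{K}^{\mathbb{Z}}: |||x|||<\infty\}$, normed by $|||\cdot|||$; it is a Banach sequence space containing $X$ as a closed subspace. A (possibly non-convergent) formal series $\sum_{n}x_ne_n$ denotes the sequence $(x_n)$. The bilateral weighted backward shift is $B_w(x_n)_{n\in\mathbb{Z}}=(w_{n+1}x_{n+1})_{n\in\mathbb{Z}}$. If $B_w$ is an operator on $X$ it is also an operator on $\widehat{X}$, and it is invertible on $X$ if and only if it is invertible on $\widehat{X}$. A Furstenberg family is a non-empty family $\mathcal{A}$ of subsets of $\mathbb{N}_0$ such that $A\in\mathcal{A}$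 and $A\subset B\subset\mathbb{N}_0$ imply $B\in\mathcal{A}$. A Furstenberg family $\mathcal{A}$ is called upper if it does not contain the empty set and it can be written as $\mathcal{A}=\bigcup_{\delta\in D}\mathcal{A}_\delta$ with $\mathcal{A}_\delta=\bigcap_{\mu\in M}\mathcal{A}_{\delta,\mu}$ for some families $\mathcal{A}_{\delta,\mu}$ of subsets of $\mathbb{N}_0$ ($\delta\in D,\mu\in M$), where $D$ is arbitrary but $M$ is countable, such that (i) for any $A\in\mathcal{A}_{\delta,\mu}$ there is a finite set $F\subset\mathbb{N}_0$ such that if $B\supset A\cap F$ then $B\in\mathcal{A}_{\delta,\mu}$; (ii) for any $A\in\mathcal{A}$ there is some $\delta\in D$ such that, for all $n\geq0$, $A-n\in\mathcal{A}_\delta$, where $A-n=\{k\geq0: k+n\in A\}$. An operator $T$ on a Banach space $X$ is $\mathcal{A}$-hypercyclic if there is a vector $x\in X$ such that, for any non-empty open subset $U$ of $X$, $\{n\geq0:T^nx\in U\}\in\mathcal{A}$. If $Z$ is a closed subspace of a Banach space $Y$, an operator $T$ on $Y$ is $\mathcal{A}$-hypercyclic for $Z$ if there is a vector $y\in Y$ such that, for any open subset $U$ of $Y$ with $U\cap Z\neq\varnothing$, $\{n\geq0: T^ny\in U\}\in\mathcal{A}$. *)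

theory Defs
  imports "HOL-Analysis.Analysis"
begin

text \<open>
  Scalars range over a type of sort {real_normed_field, euclidean_space}. Up to isometric
  isomorphism the instances of this sort are exactly the real and the complex field.

  A sequence space is a carrier set X of sequences indexed by int together with a norm N on
  it; the values of N outside X are irrelevant. The distance is set to 0 off the carrier because
  the locale \<^locale>\<open>Metric_space\<close> demands nonnegativity and symmetry on the whole type.
\<close>

definition seq_dist ::
    "(int \<Rightarrow> 'k::real_normed_field) set \<Rightarrow> ((int \<Rightarrow> 'k) \<Rightarrow> real) \<Rightarrow> (int \<Rightarrow> 'k) \<Rightarrow> (int \<Rightarrow> 'k) \<Rightarrow> real"
  where "seq_dist X N x y = (if x \<in> X \<and> y \<in> X then N (\<lambda>n. x n - y n) else 0)"

definition seq_top ::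
    "(int \<Rightarrow> 'k::real_normed_field) set \<Rightarrow> ((int \<Rightarrow> 'k) \<Rightarrow> real) \<Rightarrow> (int \<Rightarrow> 'k) topology"
  where "seq_top X N = Metric_space.mtopology X (seq_dist X N)"

definition normed_sequence_space ::
    "(int \<Rightarrow> 'k::real_normed_field) set \<Rightarrow> ((int \<Rightarrow> 'k) \<Rightarrow> real) \<Rightarrow> bool"
  where "normed_sequence_space X N \<longleftrightarrow>
    (\<lambda>n. 0) \<in> X \<and>
    (\<forall>x\<in>X. \<forall>y\<in>X. (\<lambda>n. x n + y n) \<in> X) \<and>
    (\<forall>c. \<forall>x\<in>X. (\<lambda>n. c * x n) \<in> X) \<and>
    (\<forall>x\<in>X. 0 \<le> N x) \<and>
    (\<forall>x\<in>X. N x = 0 \<longleftrightarrow> x = (\<lambda>n. 0)) \<and>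
    (\<forall>x\<in>X. \<forall>y\<in>X. N (\<lambda>n. x n + y n) \<le> N x + N y) \<and>
    (\<forall>c. \<forall>x\<in>X. N (\<lambda>n. c * x n) = norm c * N x)"

lemma Metric_space_seq_dist:
  fixes X :: "(int \<Rightarrow> 'k::real_normed_field) set"
  assumes X: "normed_sequence_space X N"
  shows "Metric_space X (seq_dist X N)"
proof -
  have add: "(\<lambda>n. x n + y n) \<in> X" "N (\<lambda>n. x n + y n) \<le> N x + N y" if "x \<in> X" "y \<in> X" for x y
    using X that unfolding normed_sequence_space_def by auto
  have scale: "(\<lambda>n. c * x n) \<in> X" "N (\<lambda>n. c * x n) = norm c * N x" if "x \<in> X" for c x
    using X that unfolding normed_sequence_space_def by auto
  have pos: "0 \<le> N x" "N x = 0 \<longleftrightarrow> x = (\<lambda>n. 0)" if "x \<in> X" for x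
    using X that unfolding normed_sequence_space_def by auto
  have diff: "(\<lambda>n. x n - y n) \<in> X" if "x \<in> X" "y \<in> X" for x y
    using add(1)[OF that(1) scale(1)[OF that(2), of "- 1"]] by simp
  show ?thesis
  proof
    show "0 \<le> seq_dist X N x y" for x y
      by (simp add: seq_dist_def pos diff)
    show "seq_dist X N x y = seq_dist X N y x" for x y
      using scale(2)[OF diff, of x y "- 1"] by (auto simp: seq_dist_def)
    show "seq_dist X N x y = 0 \<longleftrightarrow> x = y" if "x \<in> X" "y \<in> X" for x y
      using that by (simp add: seq_dist_def pos diff fun_eq_iff)
    show "seq_dist X N x z \<le> seq_dist X N x y + seq_dist X N y z"
      if "x \<in> X" "y \<in> X" "z \<in> X" for x y z
      using that add(2)[OF diff[OF that(1,2)] diff[OF that(2,3)]] by (simp add: seq_dist_def)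
  qed
qed

definition banach_sequence_space ::
    "(int \<Rightarrow> 'k::real_normed_field) set \<Rightarrow> ((int \<Rightarrow> 'k) \<Rightarrow> real) \<Rightarrow> bool"
  where "banach_sequence_space X N \<longleftrightarrow>
    normed_sequence_space X N \<and>
    Metric_space.mcomplete X (seq_dist X N) \<and>
    (\<forall>k. continuous_map (seq_top X N) euclidean (\<lambda>x. x k))"

definition unit_seq :: "int \<Rightarrow> int \<Rightarrow> 'k::real_normed_field"
  where "unit_seq n = (\<lambda>k. if k = n then 1 else 0)"

definition partial_sum :: "(int \<Rightarrow> 'k::real_normed_field) \<Rightarrow> int set \<Rightarrow> int \<Rightarrow> 'k"
  where "partial_sum x F = (\<lambda>i. \<Sum>k\<in>F. x k * unit_seq k i)"

definition unit_basis ::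
    "(int \<Rightarrow> 'k::real_normed_field) set \<Rightarrow> ((int \<Rightarrow> 'k) \<Rightarrow> real) \<Rightarrow> bool"
  where "unit_basis X N \<longleftrightarrow>
    (\<forall>n. unit_seq n \<in> X) \<and>
    (\<forall>x\<in>X. limitin (seq_top X N) (\<lambda>(m, n). partial_sum x {- int m..int n}) x
              (sequentially \<times>\<^sub>F sequentially))"

text \<open>
  Unconditional convergence is convergence of the net of finite partial sums, exactly as in
  \<^const>\<open>has_sum\<close>, which itself is not available for topologies given on a carrier set.
\<close>

definition unconditional_unit_basis ::
    "(int \<Rightarrow> 'k::real_normed_field) set \<Rightarrow> ((int \<Rightarrow> 'k) \<Rightarrow> real) \<Rightarrow> bool"
  where "unconditional_unit_basis X N \<longleftrightarrow>
    unit_basis X N \<and>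
    (\<forall>x\<in>X. limitin (seq_top X N) (partial_sum x) x (finite_subsets_at_top UNIV))"

definition triple_norm ::
    "((int \<Rightarrow> 'k::real_normed_field) \<Rightarrow> real) \<Rightarrow> (int \<Rightarrow> 'k) \<Rightarrow> ennreal"
  where "triple_norm N x = (SUP (m, n)\<in>UNIV. ennreal (N (partial_sum x {- int m..int n})))"

definition hat_space :: "((int \<Rightarrow> 'k::real_normed_field) \<Rightarrow> real) \<Rightarrow> (int \<Rightarrow> 'k) set"
  where "hat_space N = {x. triple_norm N x < \<infinity>}"

definition hat_norm :: "((int \<Rightarrow> 'k::real_normed_field) \<Rightarrow> real) \<Rightarrow> (int \<Rightarrow> 'k) \<Rightarrow> real"
  where "hat_norm N x = enn2real (triple_norm N x)"

definition operator_on ::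
    "(int \<Rightarrow> 'k::real_normed_field) set \<Rightarrow> ((int \<Rightarrow> 'k) \<Rightarrow> real) \<Rightarrow> ((int \<Rightarrow> 'k) \<Rightarrow> int \<Rightarrow> 'k) \<Rightarrow> bool"
  where "operator_on X N T \<longleftrightarrow>
    (\<forall>x\<in>X. T x \<in> X) \<and>
    (\<forall>x\<in>X. \<forall>y\<in>X. T (\<lambda>n. x n + y n) = (\<lambda>n. T x n + T y n)) \<and>
    (\<forall>c. \<forall>x\<in>X. T (\<lambda>n. c * x n) = (\<lambda>n. c * T x n)) \<and>
    continuous_map (seq_top X N) (seq_top X N) T"

definition invertible_on ::
    "(int \<Rightarrow> 'k::real_normed_field) set \<Rightarrow> ((int \<Rightarrow> 'k) \<Rightarrow> real) \<Rightarrow> ((int \<Rightarrow> 'k) \<Rightarrow> int \<Rightarrow> 'k) \<Rightarrow> bool"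
  where "invertible_on X N T \<longleftrightarrow>
    operator_on X N T \<and> (\<exists>S. operator_on X N S \<and> (\<forall>x\<in>X. S (T x) = x \<and> T (S x) = x))"

definition weighted_shift :: "(int \<Rightarrow> 'k::real_normed_field) \<Rightarrow> (int \<Rightarrow> 'k) \<Rightarrow> int \<Rightarrow> 'k"
  where "weighted_shift w x = (\<lambda>n. w (n + 1) * x (n + 1))"

definition shift_coeff :: "(int \<Rightarrow> 'k::real_normed_field) \<Rightarrow> int \<Rightarrow> 'k"
  where "shift_coeff w n =
    (if n > 0 then 1 / (\<Prod>k\<in>{1..n}. w k)
     else if n = 0 then 1
     else (\<Prod>k\<in>{n + 1..0}. w k))"

definition furstenberg_family :: "nat set set \<Rightarrow> bool"
  where "furstenberg_family \<A> \<longleftrightarrow> \<A> \<noteq> {} \<and> (\<forall>A B. A \<in> \<A> \<and> A \<subseteq> B \<longrightarrow> B \<in> \<A>)"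

text \<open>
  The family is upper, as witnessed by the index sets D and M and the families AA d m. The
  witnesses are parameters since they live in arbitrary types, over which a definition cannot
  quantify existentially.
\<close>

definition upper_furstenberg_family ::
    "nat set set \<Rightarrow> 'd set \<Rightarrow> 'm set \<Rightarrow> ('d \<Rightarrow> 'm \<Rightarrow> nat set set) \<Rightarrow> bool"
  where "upper_furstenberg_family \<A> D M AA \<longleftrightarrow>
    furstenberg_family \<A> \<and> {} \<notin> \<A> \<and> countable M \<and>
    \<A> = (\<Union>\<delta>\<in>D. \<Inter>\<mu>\<in>M. AA \<delta> \<mu>) \<and>
    (\<forall>\<delta>\<in>D. \<forall>\<mu>\<in>M. \<forall>A\<in>AA \<delta> \<mu>. \<exists>F. finite F \<and> (\<forall>B. A \<inter> F \<subseteq> B \<longrightarrow> B \<in> AA \<delta> \<mu>)) \<and>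
    (\<forall>A\<in>\<A>. \<exists>\<delta>\<in>D. \<forall>n. {k. k + n \<in> A} \<in> (\<Inter>\<mu>\<in>M. AA \<delta> \<mu>))"

definition hypercyclic ::
    "nat set set \<Rightarrow> (int \<Rightarrow> 'k::real_normed_field) set \<Rightarrow> ((int \<Rightarrow> 'k) \<Rightarrow> real)
      \<Rightarrow> ((int \<Rightarrow> 'k) \<Rightarrow> int \<Rightarrow> 'k) \<Rightarrow> bool"
  where "hypercyclic \<A> X N T \<longleftrightarrow>
    (\<exists>x\<in>X. \<forall>U. openin (seq_top X N) U \<and> U \<noteq> {} \<longrightarrow> {n. (T ^^ n) x \<in> U} \<in> \<A>)"

definition hypercyclic_for ::
    "nat set set \<Rightarrow> (int \<Rightarrow> 'k::real_normed_field) set \<Rightarrow> ((int \<Rightarrow> 'k) \<Rightarrow> real)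
      \<Rightarrow> ((int \<Rightarrow> 'k) \<Rightarrow> int \<Rightarrow> 'k) \<Rightarrow> (int \<Rightarrow> 'k) set \<Rightarrow> bool"
  where "hypercyclic_for \<A> Y N T Z \<longleftrightarrow>
    (\<exists>y\<in>Y. \<forall>U. openin (seq_top Y N) U \<and> U \<inter> Z \<noteq> {} \<longrightarrow> {n. (T ^^ n) y \<in> U} \<in> \<A>)"

text \<open>
  For fixed m and j the indices n - m + j are pairwise distinct, so the formal series of
  v(n - m + j) e(n - m + j) over n in A, n different from m, is the sequence v restricted to
  these indices.
\<close>

definition shifted_series ::
    "(int \<Rightarrow> 'k::real_normed_field) \<Rightarrow> nat set \<Rightarrow> nat \<Rightarrow> int \<Rightarrow> int \<Rightarrow> 'k"
  where "shifted_series v A m j =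
    (\<lambda>k. if \<exists>n\<in>A. n \<noteq> m \<and> k = int n - int m + j then v k else 0)"

definition positive_null_seq :: "(nat \<Rightarrow> real) \<Rightarrow> bool"
  where "positive_null_seq \<epsilon> \<longleftrightarrow> (\<forall>p\<ge>1. 0 < \<epsilon> p) \<and> \<epsilon> \<longlonglongrightarrow> 0"

text \<open>Sequences indexed by positive integers are functions on nat whose value at 0 is ignored.\<close>

definition separated_sets ::
    "nat set set \<Rightarrow> ((int \<Rightarrow> 'k::real_normed_field) \<Rightarrow> real) \<Rightarrow> (int \<Rightarrow> 'k)
      \<Rightarrow> (nat \<Rightarrow> int set) \<Rightarrow> (nat \<Rightarrow> real) \<Rightarrow> bool"
  where "separated_sets \<A> N v J \<epsilon> \<longleftrightarrow>
    (\<exists>A :: nat \<Rightarrow> nat set.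
      (\<forall>p\<ge>1. A p \<in> \<A>) \<and> disjoint_family_on A {1..} \<and>
      (\<forall>p\<ge>1. \<forall>q\<ge>1. \<forall>m\<in>A q. \<forall>j\<in>J p.
        triple_norm N (shifted_series v (A p) m j) < ennreal (min (\<epsilon> p) (\<epsilon> q))))"

end

theory Submission
  imports Defs
begin

text \<open>
  In the coordinates \<open>x k / v k\<close>, with \<open>v = shift_coeff w\<close>, the operator is the unweighted
  backward shift, and the \<open>m\<close>-th iterate of \<open>x\<close> has the \<open>k\<close>-th coordinate
  \<open>v k * (x (k + m) / v (k + m))\<close>. So \<open>x\<close> is hypercyclic if its rescaled coordinates contain copies
  of many finite patterns, and if the remainder of the sequence, seen from the position of a copy
  and weighted by \<open>v\<close>, is small. The norm inequalities say that copies placed around the elements of the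
  sets \<open>A p\<close> do not disturb each other.

  The proof runs through a cycle. A hypercyclic vector of \<open>X\<close> is hypercyclic for \<open>X\<close> in the enlarged
  space, whose norm on \<open>X\<close> is at most a multiple of the given one. Return times of a vector of the
  enlarged space to patterns that are constant on \<open>[-p, p]\<close>, with heights chosen to identify
  \<open>p\<close>, yield the sets for every prescribed null sequence
  (\<open>hypercyclic_for_imp_separated_sets\<close>). Given the sets for one null sequence, a sparse
  subsequence of them serves any other (\<open>separated_sets_reindex\<close>), and copies of a dense sequence
  of patterns around their elements add up to a vector of the enlarged space that is hypercyclic
  for \<open>X\<close> (\<open>separated_sets_imp_hypercyclic_for\<close>). Finally, truncations of the iterates of such a
  vector show that the vectors of \<open>X\<close> returning sufficiently often to a given ball are a countable
  intersection of dense open sets, and Baire's theorem provides a hypercyclic vector of \<open>X\<close>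
  (\<open>hypercyclic_for_imp_hypercyclic\<close>).

  Unconditionality of the basis is used in the form of \<open>domination\<close>: on the enlarged space,
  decreasing the moduli of the coordinates increases the norm at most by a constant factor. Such a
  factor exists because the truncations to finite sets are uniformly bounded and because a
  multiplier with values in \<open>[0, 1]\<close> is an average of truncations.

  If the shift is invertible, then changing \<open>j\<close> by one changes the norms of the series at most by a
  constant factor, and exponentially decaying bounds for \<open>j = 0\<close> imply bounds for all \<open>\<bar>j\<bar> \<le> p\<close>.
\<close>

section \<open>Normed sequence spaces\<close>

locale normed_seq =
  fixes X :: "(int \<Rightarrow> 'k::real_normed_field) set" and N :: "(int \<Rightarrow> 'k) \<Rightarrow> real"
  assumes normed: "normed_sequence_space X N"
begin

lemma zero_mem: "(\<lambda>n. 0) \<in> X"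
  and add_mem: "x \<in> X \<Longrightarrow> y \<in> X \<Longrightarrow> (\<lambda>n. x n + y n) \<in> X"
  and scale_mem: "x \<in> X \<Longrightarrow> (\<lambda>n. c * x n) \<in> X"
  and norm_nonneg: "x \<in> X \<Longrightarrow> 0 \<le> N x"
  and norm_eq_0: "x \<in> X \<Longrightarrow> N x = 0 \<longleftrightarrow> x = (\<lambda>n. 0)"
  and norm_add: "x \<in> X \<Longrightarrow> y \<in> X \<Longrightarrow> N (\<lambda>n. x n + y n) \<le> N x + N y"
  and norm_scale: "x \<in> X \<Longrightarrow> N (\<lambda>n. c * x n) = norm c * N x"
  using normed unfolding normed_sequence_space_def by auto

lemma norm_zero: "N (\<lambda>n. 0) = 0"
  using norm_eq_0[OF zero_mem] by simp

lemma diff_mem: "x \<in> X \<Longrightarrow> y \<in> X \<Longrightarrow> (\<lambda>n. x n - y n) \<in> X"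
  using add_mem[OF _ scale_mem[of y "-1"], of x] by simp

lemma norm_diff_commute: "x \<in> X \<Longrightarrow> y \<in> X \<Longrightarrow> N (\<lambda>n. x n - y n) = N (\<lambda>n. y n - x n)"
  using norm_scale[OF diff_mem[of x y], of "-1"] by simp

lemma norm_diff: "x \<in> X \<Longrightarrow> y \<in> X \<Longrightarrow> N (\<lambda>n. x n - y n) \<le> N x + N y"
  using norm_add[OF _ scale_mem[of y "-1"], of x] norm_scale[of y "-1"] by simp

lemma norm_triangle:
  "x \<in> X \<Longrightarrow> y \<in> X \<Longrightarrow> z \<in> X \<Longrightarrow> N (\<lambda>n. x n - z n) \<le> N (\<lambda>n. x n - y n) + N (\<lambda>n. y n - z n)"
  using norm_add[OF diff_mem[of x y] diff_mem[of y z]] by simp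

lemma norm_le_norm_diff: "x \<in> X \<Longrightarrow> y \<in> X \<Longrightarrow> N x \<le> N y + N (\<lambda>n. x n - y n)"
  using norm_add[OF _ diff_mem[of x y], of y] by simp

lemma sum_mem: "(\<And>i. i \<in> I \<Longrightarrow> f i \<in> X) \<Longrightarrow> (\<lambda>n. \<Sum>i\<in>I. f i n) \<in> X"
  by (induction I rule: infinite_finite_induct) (auto intro: zero_mem add_mem)

lemma norm_sum:
  "(\<And>i. i \<in> I \<Longrightarrow> f i \<in> X) \<Longrightarrow> N (\<lambda>n. \<Sum>i\<in>I. f i n) \<le> (\<Sum>i\<in>I. N (f i))"
proof (induction I rule: infinite_finite_induct)
  case (insert i I)
  then have "N (\<lambda>n. f i n + (\<Sum>i\<in>I. f i n)) \<le> N (f i) + N (\<lambda>n. \<Sum>i\<in>I. f i n)"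
    by (intro norm_add sum_mem) auto
  with insert show ?case by auto
qed (auto simp: norm_zero)

sublocale Metric_space X "seq_dist X N"
  by (rule Metric_space_seq_dist[OF normed])

lemma seq_top_eq: "seq_top X N = mtopology"
  by (simp add: seq_top_def)

lemma topspace_seq_top [simp]: "topspace (seq_top X N) = X"
  by (simp add: seq_top_eq)

lemma mball_eq: "x \<in> X \<Longrightarrow> mball x r = {y \<in> X. N (\<lambda>n. y n - x n) < r}"
  using norm_diff_commute[of x] by (auto simp: mball_def seq_dist_def)

lemma openin_iff:
  "openin (seq_top X N) U \<longleftrightarrow>
    U \<subseteq> X \<and> (\<forall>x\<in>U. \<exists>r>0. \<forall>y\<in>X. N (\<lambda>n. y n - x n) < r \<longrightarrow> y \<in> U)"
proof -
  have "(\<exists>r>0. mball x r \<subseteq> U) \<longleftrightarrow> (\<exists>r>0. \<forall>y\<in>X. N (\<lambda>n. y n - x n) < r \<longrightarrow> y \<in> U)"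
    if "x \<in> X" for x
    by (auto simp: mball_eq[OF that])
  then show ?thesis
    by (auto simp: seq_top_eq openin_mtopology subset_iff)
qed

lemma openin_ball: "x \<in> X \<Longrightarrow> openin (seq_top X N) {y \<in> X. N (\<lambda>n. y n - x n) < r}"
  using openin_mball[of x r] by (simp add: seq_top_eq mball_eq)

text \<open>
  Both the uniform bound on truncations and the passage from approximate to genuine
  hypercyclicity choose a point in countably many dense open sets; stating density and
  openness through the norm keeps topological closures out of those proofs.
\<close>

lemma Baire_balls:
  assumes "mcomplete" "countable I"
    and sub: "\<And>i. i \<in> I \<Longrightarrow> G i \<subseteq> X"
    and op: "\<And>i x. i \<in> I \<Longrightarrow> x \<in> G i \<Longrightarrow> \<exists>r>0. \<forall>y\<in>X. N (\<lambda>n. y n - x n) < r \<longrightarrow> y \<in> G i"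
    and dense: "\<And>i x r. i \<in> I \<Longrightarrow> x \<in> X \<Longrightarrow> 0 < r \<Longrightarrow> \<exists>y\<in>G i. N (\<lambda>n. y n - x n) < r"
  shows "\<exists>x\<in>X. \<forall>i\<in>I. x \<in> G i"
proof -
  have "mtopology closure_of \<Inter>(insert X (G ` I)) = X"
  proof (rule metric_Baire_category[OF \<open>mcomplete\<close>])
    show "countable (insert X (G ` I))"
      using \<open>countable I\<close> by simp
    fix T assume "T \<in> insert X (G ` I)"
    then consider "T = X" | i where "i \<in> I" "T = G i"
      by auto
    then show "openin mtopology T \<and> mtopology closure_of T = X"
    proof cases
      case 1
      then show ?thesis
        by (metis closure_of_topspace openin_topspace topspace_mtopology)
    next
      case 2
      have "openin mtopology T"
        using openin_iff[of T] sub[OF 2(1)] op[OF 2(1)] unfolding 2(2) seq_top_eq by blast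
      moreover have "x \<in> mtopology closure_of T" if x: "x \<in> X" for x
      proof -
        have "\<exists>y. y \<in> T \<and> y \<in> mball x r" if "r > 0" for r
          using dense[OF 2(1) x that] sub[OF 2(1)] x by (auto simp: 2(2) mball_eq)
        then show ?thesis
          using x by (auto simp: metric_closure_of)
      qed
      ultimately show ?thesis
        using closure_of_subset_topspace[of mtopology T] by auto
    qed
  qed
  then have "\<Inter>(insert X (G ` I)) \<noteq> {}"
    using zero_mem by force
  then show ?thesis
    by auto
qed

text \<open>
  Scaling turns a bound near the origin into a bound by a multiple of the norm; this serves for
  linear maps into various normed spaces, hence the homogeneous real function \<open>f\<close>.
\<close>

lemma homogeneous_bounded:
  assumes hom: "\<And>c x. x \<in> X \<Longrightarrow> f (\<lambda>n. c * x n) = norm c * f x"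
    and "0 < d" "0 < b" and bd: "\<And>x. x \<in> X \<Longrightarrow> N x < d \<Longrightarrow> f x \<le> b"
    and x: "x \<in> X"
  shows "f x \<le> 2 * b / d * N x"
proof (cases "N x = 0")
    case True
    then have "f x = 0"
      using norm_eq_0[OF x] hom[OF x, of 0] by simp
    then show ?thesis using True by simp
  next
    case False
    then have pos: "N x > 0"
      using norm_nonneg[OF x] by simp
    let ?c = "of_real (d / (2 * N x)) :: 'k"
    have c: "norm ?c = d / (2 * N x)"
      using pos \<open>0 < d\<close> by (simp only: norm_of_real) simp
    have "N (\<lambda>n. ?c * x n) < d"
      using norm_scale[OF x, of ?c] pos \<open>0 < d\<close> unfolding c by simp
    then have "d / (2 * N x) * f x \<le> b"
      using bd[OF scale_mem[OF x, of ?c]] hom[OF x, of ?c] unfolding c by simp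
    then show ?thesis
      using pos \<open>0 < d\<close> by (simp add: field_simps)
qed

lemma continuous_at_0_nbhd:
  assumes "continuous_map (seq_top X N) Y f" "openin Y V" "f (\<lambda>n. 0) \<in> V"
  shows "\<exists>d>0. \<forall>x\<in>X. N x < d \<longrightarrow> f x \<in> V"
proof -
  have "openin (seq_top X N) {x \<in> X. f x \<in> V}"
    using openin_continuous_map_preimage[OF assms(1,2)] by simp
  moreover have "(\<lambda>n. 0) \<in> {x \<in> X. f x \<in> V}"
    using assms(3) zero_mem by simp
  ultimately obtain r where "r > 0" "\<forall>y\<in>X. N (\<lambda>n. y n - 0) < r \<longrightarrow> y \<in> {x \<in> X. f x \<in> V}"
    unfolding openin_iff by meson
  then show ?thesis
    by (intro exI[of _ r]) simp
qed

lemma continuous_functional_bounded: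
  assumes "continuous_map (seq_top X N) euclidean (\<lambda>x. x k)"
  shows "\<exists>C>0. \<forall>x\<in>X. norm (x k) \<le> C * N x"
proof -
  obtain d where "d > 0" and d: "\<And>x. x \<in> X \<Longrightarrow> N x < d \<Longrightarrow> x k \<in> ball 0 1"
    using continuous_at_0_nbhd[OF assms, of "ball 0 1"] by auto
  have "norm (x k) \<le> 2 * 1 / d * N x" if "x \<in> X" for x
    by (rule homogeneous_bounded[OF _ \<open>0 < d\<close> zero_less_one _ that])
      (use d in \<open>force simp: norm_mult dist_norm\<close>)+
  then show ?thesis
    using \<open>0 < d\<close> by (intro exI[of _ "2 * 1 / d"]) auto
qed

lemma operator_bounded:
  assumes "operator_on X N T"
  shows "\<exists>C>0. \<forall>x\<in>X. N (T x) \<le> C * N x"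
proof -
  have T: "T x \<in> X" "T (\<lambda>n. c * x n) = (\<lambda>n. c * T x n)" if "x \<in> X" for x c
    using assms that unfolding operator_on_def by auto
  have T0: "T (\<lambda>n. 0) = (\<lambda>n. 0)"
    using T(2)[OF zero_mem, of 0] by simp
  obtain d where "d > 0"
    and d: "\<And>x. x \<in> X \<Longrightarrow> N x < d \<Longrightarrow> T x \<in> {y \<in> X. N (\<lambda>n. y n - 0) < 1}"
    using continuous_at_0_nbhd[of "seq_top X N" T, OF _ openin_ball[OF zero_mem, of 1]] assms
      zero_mem norm_zero T0 unfolding operator_on_def by auto
  have "N (T x) \<le> 2 * 1 / d * N x" if "x \<in> X" for x
    by (rule homogeneous_bounded[OF _ \<open>0 < d\<close> zero_less_one _ that])
      (use d T in \<open>force simp: norm_scale\<close>)+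
  then show ?thesis
    using \<open>0 < d\<close> by (intro exI[of _ "2 * 1 / d"]) auto
qed

end

section \<open>Finite truncations and the basis constant\<close>

lemma partial_sum_apply: "finite F \<Longrightarrow> partial_sum x F i = (if i \<in> F then x i else 0)"
proof -
  assume "finite F"
  moreover have "(\<Sum>k\<in>F. x k * unit_seq k i) = (\<Sum>k\<in>F. if k = i then x i else 0)"
    by (rule sum.cong) (auto simp: unit_seq_def)
  ultimately show ?thesis
    by (simp add: partial_sum_def)
qed

locale unconditional_space =
  fixes X :: "(int \<Rightarrow> 'k::{real_normed_field, euclidean_space}) set"
    and N :: "(int \<Rightarrow> 'k) \<Rightarrow> real"
  assumes banach: "banach_sequence_space X N"
    and uncond: "unconditional_unit_basis X N"
begin

sublocale normed_seq X N
  by unfold_locales (use banach in \<open>simp add: banach_sequence_space_def\<close>)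

lemma mcomplete: "mcomplete"
  using banach by (simp add: banach_sequence_space_def)

lemma unit_mem: "unit_seq n \<in> X"
  using uncond by (simp add: unconditional_unit_basis_def unit_basis_def)

lemma partial_sum_mem: "partial_sum x F \<in> X"
  unfolding partial_sum_def by (intro sum_mem scale_mem unit_mem)

lemma norm_unit_pos: "0 < N (unit_seq k)"
proof -
  have "unit_seq k k \<noteq> (0::'k)"
    by (simp add: unit_seq_def)
  then have "unit_seq k \<noteq> (\<lambda>n. 0 :: 'k)"
    by metis
  then show ?thesis
    using norm_eq_0[OF unit_mem] norm_nonneg[OF unit_mem] by (metis less_eq_real_def)
qed

lemma norm_partial_sum_le: "N (partial_sum x F) \<le> (\<Sum>k\<in>F. norm (x k) * N (unit_seq k))"
proof -
  have "N (partial_sum x F) \<le> (\<Sum>k\<in>F. N (\<lambda>i. x k * unit_seq k i))"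
    unfolding partial_sum_def by (intro norm_sum scale_mem unit_mem)
  then show ?thesis
    by (simp add: norm_scale[OF unit_mem])
qed

lemma norm_partial_sum_singleton: "N (partial_sum x {k}) = norm (x k) * N (unit_seq k)"
  by (simp add: partial_sum_def norm_scale[OF unit_mem])

lemma coordinate_bounded: "\<exists>C>0. \<forall>x\<in>X. norm (x k) \<le> C * N x"
  using continuous_functional_bounded banach by (simp add: banach_sequence_space_def)

lemma partial_sum_bounded: "\<exists>C>0. \<forall>x\<in>X. N (partial_sum x F) \<le> C * N x"
proof -
  obtain K where K: "\<And>k. 0 < K k" "\<And>k x. x \<in> X \<Longrightarrow> norm (x k) \<le> K k * N x"
    using coordinate_bounded by metis
  show ?thesis
  proof (intro exI conjI ballI)
    have "0 \<le> (\<Sum>k\<in>F. K k * N (unit_seq k))"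
      using K(1) norm_unit_pos by (intro sum_nonneg) (simp add: less_imp_le)
    then show "0 < (\<Sum>k\<in>F. K k * N (unit_seq k)) + 1"
      by simp
    fix x assume x: "x \<in> X"
    have "N (partial_sum x F) \<le> (\<Sum>k\<in>F. norm (x k) * N (unit_seq k))"
      by (rule norm_partial_sum_le)
    also have "\<dots> \<le> (\<Sum>k\<in>F. K k * N x * N (unit_seq k))"
      using K(2)[OF x] norm_unit_pos by (intro sum_mono mult_right_mono) (auto simp: less_imp_le)
    also have "\<dots> = (\<Sum>k\<in>F. K k * N (unit_seq k)) * N x"
      unfolding sum_distrib_right by (intro sum.cong refl) (simp add: mult_ac)
    also have "\<dots> \<le> ((\<Sum>k\<in>F. K k * N (unit_seq k)) + 1) * N x"
      using norm_nonneg[OF x] by (intro mult_right_mono) auto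
    finally show "N (partial_sum x F) \<le> ((\<Sum>k\<in>F. K k * N (unit_seq k)) + 1) * N x" .
  qed
qed

lemma partial_sum_add: "partial_sum (\<lambda>n. x n + y n) F = (\<lambda>n. partial_sum x F n + partial_sum y F n)"
  and partial_sum_diff: "partial_sum (\<lambda>n. x n - y n) F = (\<lambda>n. partial_sum x F n - partial_sum y F n)"
  and partial_sum_scale: "partial_sum (\<lambda>n. c * x n) F = (\<lambda>n. c * partial_sum x F n)"
  for x y :: "int \<Rightarrow> 'k"
  by (simp_all add: partial_sum_def algebra_simps sum.distrib sum_subtractf sum_distrib_left)

text \<open>
  Unconditional convergence enters as approximation by the truncations to all sufficiently
  large finite sets, not just to intervals.
\<close>

lemma finite_truncation_approx:
  assumes x: "x \<in> X" and "0 < e"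
  shows "\<exists>F0. finite F0 \<and> (\<forall>F. finite F \<and> F0 \<subseteq> F \<longrightarrow> N (\<lambda>n. partial_sum x F n - x n) < e)"
proof -
  have "limitin (seq_top X N) (partial_sum x) x (finite_subsets_at_top UNIV)"
    using uncond x by (simp add: unconditional_unit_basis_def)
  from limitinD[OF this openin_ball[OF x, of e]] x \<open>0 < e\<close>
  show ?thesis
    by (auto simp: norm_zero eventually_finite_subsets_at_top)
qed

text \<open>
  Let \<open>F0\<close> be so large that truncations to supersets of \<open>F0\<close> are within 1 of the vector. A
  truncation to an arbitrary \<open>F\<close> differs from the one to \<open>F \<union> F0\<close> only in coordinates from the
  fixed set \<open>F0\<close>.
\<close>

lemma truncations_pointwise_bounded:
  assumes x: "x \<in> X"
  shows "\<exists>n::nat. \<forall>F. finite F \<longrightarrow> N (partial_sum x F) \<le> n"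
proof -
  obtain F0 where F0: "finite F0" and
    F0': "\<And>F. finite F \<Longrightarrow> F0 \<subseteq> F \<Longrightarrow> N (\<lambda>n. partial_sum x F n - x n) < 1"
    using finite_truncation_approx[OF x zero_less_one] by auto
  define b where "b = N x + 1 + (\<Sum>k\<in>F0. norm (x k) * N (unit_seq k))"
  have "N (partial_sum x F) \<le> b" if F: "finite F" for F
  proof -
    have eq: "partial_sum x F = (\<lambda>n. partial_sum x (F \<union> F0) n - partial_sum x (F0 - F) n)"
      using F F0 by (auto simp: partial_sum_apply fun_eq_iff)
    have "N (partial_sum x F) \<le> N (partial_sum x (F \<union> F0)) + N (partial_sum x (F0 - F))"
      by (subst eq) (intro norm_diff partial_sum_mem)
    moreover have "N (partial_sum x (F \<union> F0)) \<le> N x + 1"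
      using norm_le_norm_diff[OF partial_sum_mem x, of x "F \<union> F0"] F0'[of "F \<union> F0"] F F0 by simp
    moreover have "N (partial_sum x (F0 - F)) \<le> (\<Sum>k\<in>F0 - F. norm (x k) * N (unit_seq k))"
      by (rule norm_partial_sum_le)
    moreover have "\<dots> \<le> (\<Sum>k\<in>F0. norm (x k) * N (unit_seq k))"
      using F0 norm_unit_pos by (intro sum_mono2) (auto simp: less_imp_le)
    ultimately show ?thesis
      by (simp add: b_def)
  qed
  moreover obtain n :: nat where "b \<le> n"
    using real_arch_simple by blast
  ultimately show ?thesis
    by (intro exI[of _ n]) force
qed

text \<open>
  Unconditional convergence bounds the truncations of each single vector; as in the uniform
  boundedness principle, Baire's theorem then yields one ball on which they are uniformly
  bounded.
\<close>

lemma truncations_uniformly_bounded: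
  "\<exists>C>0. \<forall>x\<in>X. \<forall>F. finite F \<longrightarrow> N (partial_sum x F) \<le> C * N x"
proof -
  define G where "G n = {x \<in> X. \<exists>F. finite F \<and> N (partial_sum x F) > real n}" for n :: nat
  have op: "\<exists>r>0. \<forall>y\<in>X. N (\<lambda>n. y n - x n) < r \<longrightarrow> y \<in> G i" if xG: "x \<in> G i" for i x
  proof -
    obtain F where F: "finite F" "N (partial_sum x F) > real i" and x: "x \<in> X"
      using xG by (auto simp: G_def)
    obtain C where "C > 0" and C: "\<And>x. x \<in> X \<Longrightarrow> N (partial_sum x F) \<le> C * N x"
      using partial_sum_bounded by blast
    define r where "r = (N (partial_sum x F) - i) / C"
    have "y \<in> G i" if y: "y \<in> X" and lt: "N (\<lambda>n. y n - x n) < r" for y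
    proof -
      have "N (partial_sum x F) \<le> N (partial_sum y F) + N (partial_sum (\<lambda>n. x n - y n) F)"
        unfolding partial_sum_diff by (intro norm_le_norm_diff partial_sum_mem)
      also have "N (partial_sum (\<lambda>n. x n - y n) F) \<le> C * N (\<lambda>n. y n - x n)"
        using C[OF diff_mem[OF x y]] norm_diff_commute[OF x y] by simp
      also have "\<dots> < C * r"
        using lt \<open>C > 0\<close> by simp
      also have "C * r = N (partial_sum x F) - i"
        using \<open>C > 0\<close> by (simp add: r_def)
      finally show ?thesis
        using y F(1) by (auto simp: G_def)
    qed
    then show ?thesis
      using F(2) \<open>C > 0\<close> by (intro exI[of _ r]) (auto simp: r_def)
  qed
  have "\<not> (\<forall>i x r. x \<in> X \<longrightarrow> 0 < r \<longrightarrow> (\<exists>y\<in>G i. N (\<lambda>n. y n - x n) < r))"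
  proof
    assume dense: "\<forall>i x r. x \<in> X \<longrightarrow> 0 < r \<longrightarrow> (\<exists>y\<in>G i. N (\<lambda>n. y n - x n) < r)"
    have "\<exists>x\<in>X. \<forall>i\<in>UNIV. x \<in> G i"
    proof (rule Baire_balls[OF mcomplete, where G = G])
      show "countable (UNIV :: nat set)"
        by simp
      show "G i \<subseteq> X" for i
        by (auto simp: G_def)
      show "\<exists>r>0. \<forall>y\<in>X. N (\<lambda>n. y n - x n) < r \<longrightarrow> y \<in> G i" if "x \<in> G i" for i x
        by (rule op[OF that])
      show "\<exists>y\<in>G i. N (\<lambda>n. y n - x n) < r" if "x \<in> X" "0 < r" for i x r
        using dense that by metis
    qed
    then obtain x where x: "x \<in> X" "\<And>i. x \<in> G i"
      by auto
    obtain n :: nat where n: "\<And>F. finite F \<Longrightarrow> N (partial_sum x F) \<le> n"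
      using truncations_pointwise_bounded[OF x(1)] by blast
    obtain F where "finite F" "N (partial_sum x F) > n"
      using x(2)[of n] by (auto simp: G_def)
    then show False
      using n[of F] by simp
  qed
  then obtain i a r where a: "a \<in> X" and "0 < r" and "\<not> (\<exists>y\<in>G i. N (\<lambda>n. y n - a n) < r)"
    by meson
  then have nG: "\<And>y. N (\<lambda>n. y n - a n) < r \<Longrightarrow> y \<notin> G i"
    by meson
  have E: "N (partial_sum y F) \<le> i" if "y \<in> X" "N (\<lambda>n. y n - a n) < r" "finite F" for y F
    using nG[OF that(2)] that(1,3) by (force simp: G_def)
  have "N (partial_sum x F) \<le> 2 * (2 * real i + 1) / r * N x" if x: "x \<in> X" and F: "finite F" for x F
  proof (rule homogeneous_bounded[OF _ \<open>0 < r\<close> _ _ x])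
    show "N (partial_sum (\<lambda>n. c * x n) F) = norm c * N (partial_sum x F)" for c x
      by (simp add: partial_sum_scale norm_scale[OF partial_sum_mem])
    show "0 < 2 * real i + 1"
      by simp
    fix x assume x: "x \<in> X" and lt: "N x < r"
    have ps: "partial_sum x F = (\<lambda>n. partial_sum (\<lambda>n. a n + x n) F n - partial_sum a F n)"
      by (simp add: partial_sum_add)
    have "N (partial_sum x F) \<le> N (partial_sum (\<lambda>n. a n + x n) F) + N (partial_sum a F)"
      by (subst ps) (intro norm_diff partial_sum_mem)
    moreover have "N (partial_sum (\<lambda>n. a n + x n) F) \<le> i"
      using lt by (intro E add_mem a x F) simp
    moreover have "N (partial_sum a F) \<le> i"
      using \<open>0 < r\<close> by (intro E a F) (simp add: norm_zero)
    ultimately show "N (partial_sum x F) \<le> 2 * real i + 1"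
      by simp
  qed
  then show ?thesis
    using \<open>0 < r\<close> by (intro exI[of _ "2 * (2 * real i + 1) / r"]) auto
qed

text \<open>
  Each multiplier \<open>a k \<in> [0, 1]\<close> enters affinely and the norm is convex, so the
  norm of the product is largest when all multipliers are 0 or 1, that is, for a truncation.
\<close>

lemma unit_interval_multiplier:
  assumes F: "finite F" and G: "finite G" "F \<inter> G = {}"
    and bd: "\<And>H. finite H \<Longrightarrow> N (partial_sum x H) \<le> b"
    and a: "\<And>k. k \<in> F \<Longrightarrow> 0 \<le> a k \<and> a k \<le> 1"
  shows "N (\<lambda>k. partial_sum (\<lambda>k. of_real (a k) * x k) F k + partial_sum x G k) \<le> b"
  using F G a
proof (induction F arbitrary: G)
  case empty
  then show ?case
    using bd by (simp add: partial_sum_def)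
next
  case (insert i F)
  define V where "V G = (\<lambda>k. partial_sum (\<lambda>k. of_real (a k) * x k) F k + partial_sum x G k)" for G
  have V: "V G \<in> X" for G
    unfolding V_def by (intro add_mem partial_sum_mem)
  have IH: "N (V G) \<le> b" "N (V (insert i G)) \<le> b"
    using insert unfolding V_def by auto
  have ai: "0 \<le> a i" "a i \<le> 1"
    using insert.prems by auto
  have eq: "(\<lambda>k. partial_sum (\<lambda>k. of_real (a k) * x k) (insert i F) k + partial_sum x G k)
      = (\<lambda>k. of_real (a i) * V (insert i G) k + of_real (1 - a i) * V G k)"
    using insert by (auto simp: V_def partial_sum_apply fun_eq_iff algebra_simps)
  have "N (\<lambda>k. of_real (a i) * V (insert i G) k + of_real (1 - a i) * V G k)
      \<le> N (\<lambda>k. of_real (a i) * V (insert i G) k) + N (\<lambda>k. of_real (1 - a i) * V G k)"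
    by (intro norm_add scale_mem V)
  also have "\<dots> = a i * N (V (insert i G)) + (1 - a i) * N (V G)"
    using ai by (simp only: norm_scale[OF V] norm_of_real)
  also have "\<dots> \<le> a i * b + (1 - a i) * b"
    using IH ai by (intro add_mono mult_left_mono) auto
  finally have "N (\<lambda>k. of_real (a i) * V (insert i G) k + of_real (1 - a i) * V G k) \<le> b"
    by (simp add: algebra_simps)
  then show ?case
    by (simp only: eq)
qed

text \<open>
  General scalar multipliers are reduced to multipliers in \<open>[0, 1]\<close> by writing them in the
  finite real basis of the scalar field and splitting each component into positive and negative
  part. This treats real and complex scalars alike.
\<close>

lemma multiplier_bounded:
  assumes F: "finite F" and bd: "\<And>H. finite H \<Longrightarrow> N (partial_sum x H) \<le> b"
    and c: "\<And>k. k \<in> F \<Longrightarrow> norm (c k) \<le> 1"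
  shows "N (partial_sum (\<lambda>k. c k * x k) F)
    \<le> (\<Sum>e\<in>(Basis :: 'k set). norm e) * (2 * b)"
proof -
  define pos neg where "pos e k = max 0 (c k \<bullet> e)" and "neg e k = max 0 (- (c k \<bullet> e))" for e k
  define R where "R a = partial_sum (\<lambda>k. of_real (a k) * x k) F" for a
  have R: "R a \<in> X" for a
    unfolding R_def by (rule partial_sum_mem)
  have NR: "N (R a) \<le> b" if "\<And>k. k \<in> F \<Longrightarrow> 0 \<le> a k \<and> a k \<le> 1" for a
    using unit_interval_multiplier[OF F finite.emptyI _ bd, where a=a] that
    by (simp add: R_def partial_sum_def)
  have "\<bar>c k \<bullet> e\<bar> \<le> 1" if "k \<in> F" "e \<in> Basis" for k e
    using Basis_le_norm[OF that(2), of "c k"] c[OF that(1)] by simp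
  then have NRe: "N (\<lambda>k. R (pos e) k - R (neg e) k) \<le> 2 * b" if "e \<in> Basis" for e
    using norm_diff[OF R R, of "pos e" "neg e"] NR[of "pos e"] NR[of "neg e"] that
    by (fastforce simp: pos_def neg_def abs_le_iff)
  have "c k = (\<Sum>e\<in>Basis. e * (of_real (pos e k) - of_real (neg e k)))" for k
  proof -
    have "c k = (\<Sum>e\<in>Basis. (c k \<bullet> e) *\<^sub>R e)"
      by (rule euclidean_representation[symmetric])
    also have "\<dots> = (\<Sum>e\<in>Basis. e * (of_real (pos e k) - of_real (neg e k)))"
      by (intro sum.cong refl) (auto simp: pos_def neg_def scaleR_conv_of_real max_def mult.commute)
    finally show ?thesis .
  qed
  then have "c k * x k = (\<Sum>e\<in>Basis. e * (of_real (pos e k) - of_real (neg e k))) * x k" for k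
    by metis
  then have "c k * x k = (\<Sum>e\<in>Basis. e * (of_real (pos e k) * x k - of_real (neg e k) * x k))" for k
    unfolding sum_distrib_right by (simp add: algebra_simps)
  then have eq: "partial_sum (\<lambda>k. c k * x k) F
      = (\<lambda>k. \<Sum>e\<in>Basis. e * (R (pos e) k - R (neg e) k))"
    using F by (auto simp: R_def partial_sum_apply fun_eq_iff)
  have "N (\<lambda>k. \<Sum>e\<in>Basis. e * (R (pos e) k - R (neg e) k)) \<le> (\<Sum>e\<in>Basis. N (\<lambda>k. e * (R (pos e) k - R (neg e) k)))"
    by (intro norm_sum scale_mem diff_mem R)
  also have "\<dots> = (\<Sum>e\<in>Basis. norm e * N (\<lambda>k. R (pos e) k - R (neg e) k))"
    by (simp add: norm_scale[OF diff_mem[OF R R]])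
  also have "\<dots> \<le> (\<Sum>e\<in>(Basis :: 'k set). norm e * (2 * b))"
    by (intro sum_mono mult_left_mono) (use NRe in auto)
  finally have "N (\<lambda>k. \<Sum>e\<in>Basis. e * (R (pos e) k - R (neg e) k))
      \<le> (\<Sum>e\<in>(Basis :: 'k set). norm e * (2 * b))" .
  then show ?thesis
    by (simp only: eq sum_distrib_right)
qed

lemma domination_on_space:
  "\<exists>C>0. \<forall>u\<in>X. \<forall>F a. finite F \<longrightarrow> (\<forall>k\<in>F. norm (a k) \<le> norm (u k)) \<longrightarrow>
      N (partial_sum a F) \<le> C * N u"
proof -
  obtain C where "C > 0" and C: "\<And>x F. x \<in> X \<Longrightarrow> finite F \<Longrightarrow> N (partial_sum x F) \<le> C * N x"
    using truncations_uniformly_bounded by blast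
  define K where "K = (\<Sum>e\<in>(Basis :: 'k set). norm e) * (2 * C)"
  have "0 < (\<Sum>e\<in>(Basis :: 'k set). norm e)"
    by (rule sum_pos) (auto simp: nonzero_Basis)
  then have "K > 0"
    using \<open>C > 0\<close> by (simp add: K_def)
  moreover have "N (partial_sum a F) \<le> K * N u"
    if u: "u \<in> X" and F: "finite F" and le: "\<forall>k\<in>F. norm (a k) \<le> norm (u k)" for u F a
  proof -
    define c where "c k = a k / u k" for k
    have "norm (c k) \<le> 1" "c k * u k = a k" if "k \<in> F" for k
      using le that by (force simp: c_def norm_divide divide_le_eq_1)+
    moreover from this have "partial_sum a F = partial_sum (\<lambda>k. c k * u k) F"
      using F by (auto simp: partial_sum_apply fun_eq_iff)
    ultimately show ?thesis
      using multiplier_bounded[OF F C[OF u], of c] by (simp add: K_def mult.assoc)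
  qed
  ultimately show ?thesis
    by blast
qed

section \<open>The enlarged space\<close>

text \<open>
  The extended norm is a supremum of norms of interval truncations, so every estimate on the
  enlarged space reduces to a uniform estimate of these truncations in the original space.
\<close>

lemma triple_norm_le_iff:
  "0 \<le> c \<Longrightarrow> triple_norm N x \<le> ennreal c \<longleftrightarrow> (\<forall>m n. N (partial_sum x {- int m..int n}) \<le> c)"
  unfolding triple_norm_def SUP_le_iff by (simp add: split_paired_all ennreal_le_iff)

lemma hat_space_iff:
  "x \<in> hat_space N \<longleftrightarrow> (\<exists>c. \<forall>m n. N (partial_sum x {- int m..int n}) \<le> c)"
proof
  assume "x \<in> hat_space N"
  then have "triple_norm N x \<le> ennreal (hat_norm N x)"
    unfolding hat_space_def hat_norm_def by (metis ennreal_enn2real infinity_ennreal_def mem_Collect_eq order_refl)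
  then show "\<exists>c. \<forall>m n. N (partial_sum x {- int m..int n}) \<le> c"
    using triple_norm_le_iff[of "hat_norm N x"] by (auto simp: hat_norm_def)
next
  assume "\<exists>c. \<forall>m n. N (partial_sum x {- int m..int n}) \<le> c"
  then obtain c where c: "\<And>m n. N (partial_sum x {- int m..int n}) \<le> c"
    by blast
  then have "0 \<le> c"
    using norm_nonneg[OF partial_sum_mem] order_trans by blast
  then have "triple_norm N x \<le> ennreal c"
    using c by (simp add: triple_norm_le_iff)
  then show "x \<in> hat_space N"
    using le_less_trans[OF _ ennreal_less_top] by (auto simp: hat_space_def)
qed

lemma triple_norm_eq: "x \<in> hat_space N \<Longrightarrow> triple_norm N x = ennreal (hat_norm N x)"
  unfolding hat_space_def hat_norm_def by (metis ennreal_enn2real infinity_ennreal_def mem_Collect_eq)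

lemma hat_norm_nonneg: "0 \<le> hat_norm N x"
  by (simp add: hat_norm_def)

lemma triple_norm_less_iff:
  "triple_norm N x < ennreal e \<longleftrightarrow> x \<in> hat_space N \<and> hat_norm N x < e"
proof (cases "x \<in> hat_space N")
  case True
  then show ?thesis
    by (simp add: triple_norm_eq ennreal_less_iff hat_norm_nonneg)
next
  case False
  then have "triple_norm N x = \<infinity>"
    unfolding hat_space_def by (metis infinity_ennreal_def less_top mem_Collect_eq)
  with False show ?thesis
    by simp
qed

lemma interval_sum_le_hat_norm:
  "x \<in> hat_space N \<Longrightarrow> N (partial_sum x {- int m..int n}) \<le> hat_norm N x"
  using triple_norm_le_iff[OF hat_norm_nonneg, of x x] triple_norm_eq[of x] by auto

lemma hat_norm_leI:
  assumes "\<And>m n. N (partial_sum x {- int m..int n}) \<le> c"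
  shows "x \<in> hat_space N" "hat_norm N x \<le> c"
proof -
  show x: "x \<in> hat_space N"
    using assms hat_space_iff by blast
  have "0 \<le> c"
    using assms norm_nonneg[OF partial_sum_mem] order_trans by blast
  then have "ennreal (hat_norm N x) \<le> ennreal c"
    using assms triple_norm_le_iff[of c x] triple_norm_eq[OF x] by simp
  then show "hat_norm N x \<le> c"
    using \<open>0 \<le> c\<close> by simp
qed

lemma finite_int_subset_interval:
  fixes F :: "int set"
  assumes "finite F"
  shows "\<exists>L0::nat. \<forall>L\<ge>L0. F \<subseteq> {- int L..int L}"
proof (intro exI allI impI subsetI)
  fix L k assume L: "nat (\<Sum>k\<in>F. \<bar>k\<bar>) \<le> L" and k: "k \<in> F"
  have "\<bar>k\<bar> \<le> (\<Sum>k\<in>F. \<bar>k\<bar>)"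
    using k assms by (intro member_le_sum) auto
  then show "k \<in> {- int L..int L}"
    using L by auto
qed

lemma hat_norm_eq_0D: "0 = hat_norm N x \<Longrightarrow> x \<in> hat_space N \<Longrightarrow> x k = 0"
proof -
  assume *: "0 = hat_norm N x" "x \<in> hat_space N"
  let ?I = "{- int (nat \<bar>k\<bar>)..int (nat \<bar>k\<bar>)}"
  have "N (partial_sum x ?I) = 0"
    using interval_sum_le_hat_norm[OF *(2)] *(1) norm_nonneg[OF partial_sum_mem] order_antisym by metis
  then have "partial_sum x ?I k = 0"
    using norm_eq_0[OF partial_sum_mem] by simp
  then show "x k = 0"
    by (auto simp: partial_sum_apply split: if_splits)
qed

lemma hat_normed: "normed_sequence_space (hat_space N) (hat_norm N)"
proof -
  have le: "N (partial_sum x {- int m..int n}) \<le> hat_norm N x" if "x \<in> hat_space N" for x m n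
    using interval_sum_le_hat_norm[OF that] .
  have zero: "(\<lambda>n. 0) \<in> hat_space N" "hat_norm N (\<lambda>n. 0) = 0"
    using hat_norm_leI[of "\<lambda>n. 0" 0] hat_norm_nonneg[of "\<lambda>n. 0"]
    by (auto simp: partial_sum_def norm_zero)
  have add: "(\<lambda>n. x n + y n) \<in> hat_space N"
      "hat_norm N (\<lambda>n. x n + y n) \<le> hat_norm N x + hat_norm N y"
    if x: "x \<in> hat_space N" and y: "y \<in> hat_space N" for x y
  proof -
    have "N (partial_sum (\<lambda>n. x n + y n) {- int m..int n}) \<le> hat_norm N x + hat_norm N y" for m n
      using norm_add[OF partial_sum_mem partial_sum_mem, of x "{- int m..int n}" y "{- int m..int n}"]
        le[OF x, of m n] le[OF y, of m n] unfolding partial_sum_add by linarith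
    from hat_norm_leI[OF this] show "(\<lambda>n. x n + y n) \<in> hat_space N"
      "hat_norm N (\<lambda>n. x n + y n) \<le> hat_norm N x + hat_norm N y" by auto
  qed
  have scale: "(\<lambda>n. c * x n) \<in> hat_space N" "hat_norm N (\<lambda>n. c * x n) \<le> norm c * hat_norm N x"
    if x: "x \<in> hat_space N" for c x
  proof -
    have "N (partial_sum (\<lambda>n. c * x n) {- int m..int n}) \<le> norm c * hat_norm N x" for m n
      using le[OF x, of m n] by (simp add: partial_sum_scale norm_scale[OF partial_sum_mem] mult_left_mono)
    from hat_norm_leI[OF this] show "(\<lambda>n. c * x n) \<in> hat_space N"
      "hat_norm N (\<lambda>n. c * x n) \<le> norm c * hat_norm N x" by auto
  qed
  have scale_eq: "hat_norm N (\<lambda>n. c * x n) = norm c * hat_norm N x" if x: "x \<in> hat_space N" for c x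
  proof (cases "c = 0")
    case False
    have "hat_norm N x \<le> norm (inverse c) * hat_norm N (\<lambda>n. c * x n)"
      using scale(2)[OF scale(1)[OF x], of "inverse c" c] False by (simp add: mult.assoc[symmetric])
    then have "norm c * hat_norm N x \<le> norm c * (norm (inverse c) * hat_norm N (\<lambda>n. c * x n))"
      by (intro mult_left_mono) auto
    then show ?thesis
      using scale(2)[OF x, of c] False by (simp add: norm_inverse mult.assoc[symmetric])
  qed (simp add: zero)
  have "hat_norm N x = 0 \<longleftrightarrow> x = (\<lambda>n. 0)" if "x \<in> hat_space N" for x
    using hat_norm_eq_0D[OF _ that] zero(2) by auto
  then show ?thesis
    unfolding normed_sequence_space_def
    by (intro conjI ballI allI zero(1) add scale(1) scale_eq hat_norm_nonneg)
qed

sublocale hat: normed_seq "hat_space N" "hat_norm N"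
  by unfold_locales (rule hat_normed)

text \<open>
  Sequences of finite support with entries in a countable dense set of scalars serve as
  targets for the orbits: finite support is what separates blocks in an orbit and what
  survives truncation.
\<close>

lemma countable_dense_finitely_supported:
  "\<exists>Z. countable Z \<and> Z \<subseteq> X \<and> (\<forall>z\<in>Z. \<exists>L::nat. \<forall>k. \<bar>k\<bar> > int L \<longrightarrow> z k = 0) \<and>
    (\<forall>x\<in>X. \<forall>e>0. \<exists>z\<in>Z. N (\<lambda>k. z k - x k) < e)"
proof -
  obtain Q :: "'k set" where Q: "countable Q" "\<And>S. open S \<Longrightarrow> S \<noteq> {} \<Longrightarrow> \<exists>d\<in>Q. d \<in> S"
    using countable_dense_setE by blast
  define I where "I L = {- int L..int L}" for L :: nat
  define E where "E L = (\<lambda>f k. if k \<in> I L then f k else 0) ` (PiE (I L) (\<lambda>_. Q))" for L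
  have I: "finite (I L)" for L
    by (simp add: I_def)
  have E_eq: "E L = (\<lambda>f. partial_sum f (I L)) ` (PiE (I L) (\<lambda>_. Q))" for L
    unfolding E_def by (intro image_cong refl ext) (simp add: partial_sum_apply I)
  have supp: "\<forall>k. \<bar>k\<bar> > int L \<longrightarrow> z k = 0" if "z \<in> E L" for z L
    using that by (auto simp: E_def I_def abs_if split: if_splits)
  have "\<exists>z\<in>(\<Union>L. E L). N (\<lambda>k. z k - x k) < e" if x: "x \<in> X" and "0 < e" for x e
  proof -
    obtain F0 where "finite F0"
      and F0: "\<And>F. finite F \<Longrightarrow> F0 \<subseteq> F \<Longrightarrow> N (\<lambda>n. partial_sum x F n - x n) < e / 2"
      using finite_truncation_approx[OF x, of "e / 2"] \<open>0 < e\<close> by auto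
    obtain L :: nat where L: "F0 \<subseteq> I L"
      using finite_int_subset_interval[OF \<open>finite F0\<close>] by (auto simp: I_def)
    define d where "d = e / (2 * (real (card (I L)) + 1))"
    have "d > 0"
      using \<open>0 < e\<close> by (simp add: d_def)
    have "\<exists>q\<in>Q. norm (q - x k) * N (unit_seq k) < d" for k
    proof -
      have "d / N (unit_seq k) > 0"
        using \<open>d > 0\<close> norm_unit_pos[of k] by simp
      then have "ball (x k) (d / N (unit_seq k)) \<noteq> {}"
        by (simp add: not_le)
      then obtain q where "q \<in> Q" "q \<in> ball (x k) (d / N (unit_seq k))"
        using Q(2)[OF open_ball] by blast
      then show ?thesis
        using norm_unit_pos[of k]
        by (intro bexI[of _ q]) (simp_all add: dist_norm norm_minus_commute pos_less_divide_eq)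
    qed
    then obtain q where q: "\<And>k. q k \<in> Q" "\<And>k. norm (q k - x k) * N (unit_seq k) < d"
      by metis
    have "partial_sum q (I L) = (\<lambda>k. if k \<in> I L then restrict q (I L) k else 0)"
      by (auto simp: partial_sum_apply I)
    then have "partial_sum q (I L) \<in> E L"
      unfolding E_def using q(1) by (intro image_eqI[of _ _ "restrict q (I L)"]) auto
    moreover have "N (\<lambda>k. partial_sum q (I L) k - x k) < e"
    proof -
      have "N (partial_sum (\<lambda>k. q k - x k) (I L)) \<le> (\<Sum>k\<in>I L. norm (q k - x k) * N (unit_seq k))"
        by (rule norm_partial_sum_le)
      also have "\<dots> \<le> (\<Sum>k\<in>I L. d)"
        using q(2) by (intro sum_mono less_imp_le)
      also have "\<dots> \<le> e / 2"
        using \<open>0 < e\<close> by (simp add: d_def field_simps)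
      finally show ?thesis
        using norm_triangle[OF partial_sum_mem partial_sum_mem x, of q "I L" x "I L"] F0[OF I L]
        by (simp add: partial_sum_diff)
    qed
    ultimately show ?thesis by blast
  qed
  moreover have "countable (\<Union>L. E L)"
    unfolding E_def using Q(1) I by (intro countable_UN countable_image countable_PiE) auto
  moreover have "(\<Union>L. E L) \<subseteq> X"
    unfolding E_eq using partial_sum_mem by blast
  ultimately show ?thesis
    using supp by (intro exI[of _ "\<Union>L. E L"]) blast
qed

text \<open>
  The form in which unconditionality is used: on the enlarged space the norm is monotone up to
  a constant in the moduli of the coordinates.
\<close>

lemma domination:
  "\<exists>C\<ge>1. (\<forall>u\<in>X. u \<in> hat_space N \<and> hat_norm N u \<le> C * N u) \<and>
    (\<forall>u\<in>hat_space N. \<forall>a. (\<forall>k. norm (a k) \<le> norm (u k)) \<longrightarrow>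
      a \<in> hat_space N \<and> hat_norm N a \<le> C * hat_norm N u \<and>
      (\<forall>F. finite F \<longrightarrow> N (partial_sum a F) \<le> C * hat_norm N u))"
proof -
  obtain C0 where "C0 > 0" and C0: "\<forall>u\<in>X. \<forall>F a. finite F \<longrightarrow>
      (\<forall>k\<in>F. norm (a k) \<le> norm (u k)) \<longrightarrow> N (partial_sum a F) \<le> C0 * N u"
    using domination_on_space by (elim exE conjE)
  define C where "C = max 1 C0"
  have C: "N (partial_sum a F) \<le> C * N u"
    if "u \<in> X" "finite F" "\<And>k. k \<in> F \<Longrightarrow> norm (a k) \<le> norm (u k)" for u F a
  proof -
    have "N (partial_sum a F) \<le> C0 * N u"
      using C0 that by simp
    also have "\<dots> \<le> C * N u"
      using norm_nonneg[OF that(1)] by (intro mult_right_mono) (auto simp: C_def)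
    finally show ?thesis .
  qed
  have X: "u \<in> hat_space N \<and> hat_norm N u \<le> C * N u" if u: "u \<in> X" for u
    using hat_norm_leI[of u "C * N u"] C[OF u] by simp
  have fin: "N (partial_sum a F) \<le> C * hat_norm N u"
    if u: "u \<in> hat_space N" and le: "\<forall>k. norm (a k) \<le> norm (u k)" and F: "finite F" for u a F
  proof -
    obtain L :: nat where L: "F \<subseteq> {- int L..int L}"
      using finite_int_subset_interval[OF F] by blast
    have "N (partial_sum a F) \<le> C * N (partial_sum u {- int L..int L})"
      using L le by (intro C partial_sum_mem F) (auto simp: partial_sum_apply)
    also have "\<dots> \<le> C * hat_norm N u"
      using interval_sum_le_hat_norm[OF u] by (intro mult_left_mono) (auto simp: C_def)
    finally show ?thesis .
  qed
  have "a \<in> hat_space N \<and> hat_norm N a \<le> C * hat_norm N u"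
    if u: "u \<in> hat_space N" and le: "\<forall>k. norm (a k) \<le> norm (u k)" for u a
    using hat_norm_leI[of a "C * hat_norm N u"] fin[OF u le] by simp
  with X fin show ?thesis
    by (intro exI[of _ C]) (auto simp: C_def)
qed

end

section \<open>Weighted shifts and their coefficients\<close>

lemma shift_coeff_nonzero: "(\<And>n. w n \<noteq> 0) \<Longrightarrow> shift_coeff w k \<noteq> 0"
  by (auto simp: shift_coeff_def)

lemma shift_coeff_step:
  assumes w: "\<And>n. w n \<noteq> 0"
  shows "shift_coeff w k = w (k + 1) * shift_coeff w (k + 1)"
proof -
  consider "k > 0" | "k = 0" | "k = -1" | "k < -1"
    by linarith
  then show ?thesis
  proof cases
    case 1
    then have "{1..k + 1} = insert (k + 1) {1..k}"
      by auto
    then show ?thesis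
      using 1 w by (simp add: shift_coeff_def)
  next
    case 4
    then have "{k + 1..0} = insert (k + 1) {k + 1 + 1..0}"
      by auto
    then show ?thesis
      using 4 by (simp add: shift_coeff_def)
  qed (use w in \<open>auto simp: shift_coeff_def\<close>)
qed

text \<open>
  Dividing the \<open>k\<close>-th coordinate by \<open>shift_coeff w k\<close> turns the weighted shift into the
  unweighted one.
\<close>

lemma weighted_shift_funpow:
  assumes w: "\<And>n. w n \<noteq> 0"
  shows "(weighted_shift w ^^ n) x =
    (\<lambda>k. shift_coeff w k / shift_coeff w (k + int n) * x (k + int n))"
proof (induction n)
  case 0
  then show ?case
    by (simp add: shift_coeff_nonzero[OF w])
next
  case (Suc n)
  have "w (k + 1) * shift_coeff w (k + 1) = shift_coeff w k" for k
    by (rule shift_coeff_step[OF w, symmetric])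
  then have "w (k + 1) * (shift_coeff w (k + 1) / a * b) = shift_coeff w k / a * b" for k a b
    by (metis mult.assoc times_divide_eq_right)
  then have "weighted_shift w ((weighted_shift w ^^ n) x) =
      (\<lambda>k. shift_coeff w k / shift_coeff w (k + 1 + int n) * x (k + 1 + int n))"
    unfolding Suc weighted_shift_def by (simp only:)
  then show ?case
    by (simp add: add_ac)
qed

lemma weighted_shift_shifted_series:
  fixes w :: "int \<Rightarrow> 'k::real_normed_field"
  assumes w: "\<And>n. w n \<noteq> 0"
  shows "weighted_shift w (shifted_series (shift_coeff w) A m j) = shifted_series (shift_coeff w) A m (j - 1)"
proof
  fix k :: int
  have "(k + 1 = int n - int m + j) = (k = int n - int m + (j - 1))" for n
    by auto
  then show "weighted_shift w (shifted_series (shift_coeff w) A m j) k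
      = shifted_series (shift_coeff w) A m (j - 1) k"
    by (auto simp: weighted_shift_def shifted_series_def shift_coeff_step[of w k, OF w])
qed

section \<open>Separated families of sets\<close>

lemma finite_positive_lower_bound:
  fixes f :: "'b \<Rightarrow> real"
  assumes "finite S" "\<And>k. k \<in> S \<Longrightarrow> 0 < f k"
  shows "\<exists>d>0. \<forall>k\<in>S. d \<le> f k"
  using assms by (intro exI[of _ "Min (insert 1 (f ` S))"]) auto

text \<open>
  Along a sparse subsequence of the sets the numbers bounding the norms become as small as
  desired, and indices grow fast enough to admit larger shifts. With \<open>\<phi>\<close> the subsequence and
  \<open>\<epsilon> (\<phi> q) \<le> \<epsilon>' k\<close> for all \<open>k \<le> q\<close>, the bound at the larger of two indices lies below both
  prescribed numbers, as a bound by a minimum requires.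
\<close>

lemma separated_sets_reindex:
  fixes \<epsilon> \<epsilon>' :: "nat \<Rightarrow> real"
  assumes sep: "separated_sets \<A> N v J \<epsilon>" and null: "positive_null_seq \<epsilon>"
    and pos: "\<And>p. p \<ge> 1 \<Longrightarrow> 0 < \<epsilon>' p"
    and J: "\<And>p q. r * p \<le> q \<Longrightarrow> J' p \<subseteq> J q"
  shows "separated_sets \<A> N v J' \<epsilon>'"
proof -
  obtain A where A: "\<And>p. p \<ge> 1 \<Longrightarrow> A p \<in> \<A>" "disjoint_family_on A {1..}"
    and small: "\<And>p q m j. p \<ge> 1 \<Longrightarrow> q \<ge> 1 \<Longrightarrow> m \<in> A q \<Longrightarrow> j \<in> J p \<Longrightarrow>
      triple_norm N (shifted_series v (A p) m j) < ennreal (min (\<epsilon> p) (\<epsilon> q))"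
    using sep unfolding separated_sets_def by blast
  have "\<exists>P. \<forall>i\<ge>P. \<forall>k\<in>{1..p}. \<epsilon> i \<le> \<epsilon>' k" for p
  proof -
    obtain d where "d > 0" and d: "\<And>k. k \<in> {1..p} \<Longrightarrow> d \<le> \<epsilon>' k"
      using finite_positive_lower_bound[of "{1..p}" \<epsilon>'] pos by auto
    have "\<epsilon> \<longlonglongrightarrow> 0"
      using null by (simp add: positive_null_seq_def)
    then have "\<forall>\<^sub>F i in sequentially. \<epsilon> i < d"
      using \<open>d > 0\<close> by (rule order_tendstoD)
    then obtain P where "\<And>i. i \<ge> P \<Longrightarrow> \<epsilon> i < d"
      by (auto simp: eventually_sequentially)
    then show ?thesis
      using d by (intro exI[of _ P]) (meson less_imp_le order_trans)
  qed
  then obtain P where P: "\<And>p i k. i \<ge> P p \<Longrightarrow> 1 \<le> k \<Longrightarrow> k \<le> p \<Longrightarrow> \<epsilon> i \<le> \<epsilon>' k"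
    by (metis atLeastAtMost_iff)
  define \<phi> where "\<phi> p = (\<Sum>i\<le>p. P i + r * i + 1)" for p
  have \<phi>_ge: "P p + r * p + 1 \<le> \<phi> p" for p
    unfolding \<phi>_def by (rule member_le_sum[of p "{..p}" "\<lambda>i. P i + r * i + 1"]) auto
  have "strict_mono \<phi>"
    by (rule strict_monoI_Suc) (simp add: \<phi>_def)
  have \<phi>_eps: "min (\<epsilon> (\<phi> p)) (\<epsilon> (\<phi> q)) \<le> min (\<epsilon>' p) (\<epsilon>' q)" if "p \<ge> 1" "q \<ge> 1" for p q
    using P[of p "\<phi> p" p] P[of p "\<phi> p" q] P[of q "\<phi> q" p] P[of q "\<phi> q" q] \<phi>_ge[of p] \<phi>_ge[of q] that
    by (cases "p \<le> q") auto
  have ge1: "\<phi> p \<ge> 1" for p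
    using \<phi>_ge[of p] by simp
  have "triple_norm N (shifted_series v (A (\<phi> p)) m j) < ennreal (min (\<epsilon>' p) (\<epsilon>' q))"
    if pq: "p \<ge> 1" "q \<ge> 1" and m: "m \<in> A (\<phi> q)" and j: "j \<in> J' p" for p q m j
  proof -
    have "j \<in> J (\<phi> p)"
      using J[of p "\<phi> p"] \<phi>_ge[of p] j by auto
    then have "triple_norm N (shifted_series v (A (\<phi> p)) m j) < ennreal (min (\<epsilon> (\<phi> p)) (\<epsilon> (\<phi> q)))"
      by (intro small ge1 m)
    also have "\<dots> \<le> ennreal (min (\<epsilon>' p) (\<epsilon>' q))"
      by (rule ennreal_leI[OF \<phi>_eps[OF pq]])
    finally show ?thesis .
  qed
  moreover have "disjoint_family_on (\<lambda>p. A (\<phi> p)) {1..}"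
    using A(2) ge1 strict_mono_eq[OF \<open>strict_mono \<phi>\<close>] unfolding disjoint_family_on_def by simp
  ultimately show ?thesis
    unfolding separated_sets_def using A(1)[OF ge1] by (intro exI[of _ "\<lambda>p. A (\<phi> p)"]) blast
qed

lemma separated_sets_anti_mono:
  "separated_sets \<A> N v J \<epsilon> \<Longrightarrow> (\<And>p. J' p \<subseteq> J p) \<Longrightarrow> separated_sets \<A> N v J' \<epsilon>"
  unfolding separated_sets_def by (meson subsetD)

text \<open>
  Translates of a member belong to the family, so hypercyclicity may be verified for an iterate
  of a vector instead of the vector itself.
\<close>

lemma upper_furstenberg_family_translate:
  assumes "upper_furstenberg_family \<A> D M AA" "A \<in> \<A>"
  shows "{k. k + n \<in> A} \<in> \<A>"
proof -
  have eq: "\<A> = (\<Union>\<delta>\<in>D. \<Inter>\<mu>\<in>M. AA \<delta> \<mu>)"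
    and "\<forall>A\<in>\<A>. \<exists>\<delta>\<in>D. \<forall>n. {k. k + n \<in> A} \<in> (\<Inter>\<mu>\<in>M. AA \<delta> \<mu>)"
    using assms(1) unfolding upper_furstenberg_family_def by - (elim conjE, assumption)+
  then obtain \<delta> where "\<delta> \<in> D" "{k. k + n \<in> A} \<in> (\<Inter>\<mu>\<in>M. AA \<delta> \<mu>)"
    using assms(2) by meson
  then show ?thesis
    by (subst eq) (rule UN_I)
qed

lemma sum_half_powers_le: "(\<Sum>p\<in>{q<..R}. (1/2) ^ p) \<le> (1/2 :: real) ^ q"
proof -
  have "(\<Sum>p\<in>{q<..R}. (1/2) ^ p) = (1/2 :: real) ^ q - (1/2) ^ R" if "q \<le> R"
    using that
  proof (induction R rule: dec_induct)
    case (step R)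
    then have "{q<..Suc R} = insert (Suc R) {q<..R}"
      by auto
    with step show ?case by simp
  qed simp
  then show ?thesis
    by (cases "q \<le> R") auto
qed

lemma positive_null_seq_half_powers: "positive_null_seq (\<lambda>p. (1/2) ^ p)"
  unfolding positive_null_seq_def by (simp add: LIMSEQ_power_zero)

section \<open>Orbits on the space and on the enlarged space\<close>

locale weighted_shift_space = unconditional_space X N
  for X :: "(int \<Rightarrow> 'k::{real_normed_field, euclidean_space}) set" and N +
  fixes w :: "int \<Rightarrow> 'k"
  assumes w: "w n \<noteq> 0"
    and shift_operator: "operator_on X N (weighted_shift w)"
begin

abbreviation v :: "int \<Rightarrow> 'k" where "v \<equiv> shift_coeff w"
abbreviation B :: "(int \<Rightarrow> 'k) \<Rightarrow> int \<Rightarrow> 'k" where "B \<equiv> weighted_shift w"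

lemmas v_nonzero = shift_coeff_nonzero[of w, OF w]
lemmas B_funpow = weighted_shift_funpow[of w, OF w]

lemma B_funpow_mem: "x \<in> X \<Longrightarrow> (B ^^ n) x \<in> X"
  using shift_operator by (induction n) (auto simp: operator_on_def)

lemma B_funpow_diff: "(B ^^ n) (\<lambda>k. x k - y k) = (\<lambda>k. (B ^^ n) x k - (B ^^ n) y k)"
  by (simp add: B_funpow algebra_simps)

text \<open>
  The inclusion of the space into its enlargement is continuous, the new norm being at most a
  multiple of the old one.
\<close>

lemma openin_hat_trace:
  assumes U: "openin (seq_top (hat_space N) (hat_norm N)) U"
  shows "openin (seq_top X N) (U \<inter> X)"
proof -
  obtain C where "C \<ge> 1" and C: "\<And>u. u \<in> X \<Longrightarrow> u \<in> hat_space N \<and> hat_norm N u \<le> C * N u"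
    using domination by blast
  have "\<exists>r>0. \<forall>y\<in>X. N (\<lambda>n. y n - x n) < r \<longrightarrow> y \<in> U \<inter> X" if x: "x \<in> U \<inter> X" for x
  proof -
    obtain r where "r > 0" and r: "\<forall>y\<in>hat_space N. hat_norm N (\<lambda>n. y n - x n) < r \<longrightarrow> y \<in> U"
      using U x unfolding hat.openin_iff by blast
    have "y \<in> U \<inter> X" if y: "y \<in> X" and lt: "N (\<lambda>n. y n - x n) < r / C" for y
    proof -
      have "hat_norm N (\<lambda>n. y n - x n) \<le> C * N (\<lambda>n. y n - x n)"
        using C[OF diff_mem[OF y]] x by blast
      also have "\<dots> < r"
        using lt \<open>C \<ge> 1\<close> by (simp add: field_simps)
      finally show ?thesis
        using r C[OF y] y by blast
    qed
    then show ?thesis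
      using \<open>r > 0\<close> \<open>C \<ge> 1\<close> by (intro exI[of _ "r / C"]) auto
  qed
  then show ?thesis
    unfolding openin_iff by blast
qed

lemma hypercyclic_imp_hypercyclic_for:
  assumes F: "furstenberg_family \<A>" and "hypercyclic \<A> X N B"
  shows "hypercyclic_for \<A> (hat_space N) (hat_norm N) B X"
proof -
  obtain x where x: "x \<in> X"
    and hc: "\<And>U. openin (seq_top X N) U \<Longrightarrow> U \<noteq> {} \<Longrightarrow> {n. (B ^^ n) x \<in> U} \<in> \<A>"
    using assms(2) unfolding hypercyclic_def by blast
  have "{n. (B ^^ n) x \<in> U} \<in> \<A>"
    if U: "openin (seq_top (hat_space N) (hat_norm N)) U" "U \<inter> X \<noteq> {}" for U
  proof -
    have "{n. (B ^^ n) x \<in> U \<inter> X} \<in> \<A>"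
      using hc[OF openin_hat_trace] U by blast
    moreover have "{n. (B ^^ n) x \<in> U \<inter> X} \<subseteq> {n. (B ^^ n) x \<in> U}"
      by blast
    ultimately show ?thesis
      using F unfolding furstenberg_family_def by blast
  qed
  moreover have "x \<in> hat_space N"
    using domination x by blast
  ultimately show ?thesis
    unfolding hypercyclic_for_def by blast
qed

section \<open>Return sets of a hypercyclic vector\<close>

text \<open>
  In coordinates divided by \<open>v\<close>, let the \<open>p\<close>-th target be a plateau of height \<open>c p\<close> on
  \<open>[-p, p]\<close> and 0 elsewhere, and let \<open>A p\<close> be the times at which the orbit is very close to it.
  Around each time in \<open>A p\<close> the vector shows a plateau of radius \<open>p\<close> followed by near-zeros;
  since different indices have different heights, plateaus at different times cannot overlap.
  Hence, seen from a time \<open>m\<close> in \<open>A q\<close>, every other plateau lies outside \<open>[-q, q]\<close>, where the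
  iterate is the error of approximation to the \<open>q\<close>-th target. On such a plateau the error
  dominates \<open>c p / 2\<close> times \<open>v\<close>, so the series has norm at most of the order of \<open>\<delta> q / c p\<close>.
  Smallness of \<open>\<delta> q\<close> takes care of \<open>\<epsilon> q\<close>, and the size of \<open>c p\<close> of \<open>\<epsilon> p\<close>.
\<close>

lemma hypercyclic_for_imp_separated_sets:
  assumes F: "furstenberg_family \<A>"
    and hyp: "hypercyclic_for \<A> (hat_space N) (hat_norm N) B X"
    and eps: "\<And>p. p \<ge> 1 \<Longrightarrow> 0 < \<epsilon> p"
  shows "separated_sets \<A> N v (\<lambda>p. {- int p..int p}) \<epsilon>"
proof -
  obtain C where "C \<ge> 1" and XC: "\<And>u. u \<in> X \<Longrightarrow> u \<in> hat_space N"
    and dom: "\<And>u a. u \<in> hat_space N \<Longrightarrow> (\<And>k. norm (a k) \<le> norm (u k)) \<Longrightarrow>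
      a \<in> hat_space N \<and> hat_norm N a \<le> C * hat_norm N u"
    and fin: "\<And>u a F. u \<in> hat_space N \<Longrightarrow> (\<And>k. norm (a k) \<le> norm (u k)) \<Longrightarrow> finite F \<Longrightarrow>
      N (partial_sum a F) \<le> C * hat_norm N u"
    using domination by (elim exE conjE) (auto)
  have coord: "norm (u k) * N (unit_seq k) \<le> C * hat_norm N u" if "u \<in> hat_space N" for u k
    using fin[OF that, of u "{k}"] by (simp add: norm_partial_sum_singleton)
  obtain y where y: "y \<in> hat_space N"
    and hc: "\<And>U. openin (seq_top (hat_space N) (hat_norm N)) U \<Longrightarrow> U \<inter> X \<noteq> {} \<Longrightarrow>
      {n. (B ^^ n) y \<in> U} \<in> \<A>"
    using hyp unfolding hypercyclic_for_def by blast
  \<comment> \<open>Heights that differ by at least 1, so that they identify p, and outweigh the small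
    numbers of the same index in the sense that \<open>1 \<le> c p * \<epsilon> p\<close>.\<close>
  define c where "c p = (\<Sum>i=1..p. 1 + 1 / \<epsilon> i)" for p
  have c_gap: "c p + 1 + 1 / \<epsilon> q \<le> c q" if "p < q" for p q
  proof -
    have "c p + (1 + 1 / \<epsilon> q) = (\<Sum>i\<in>insert q {1..p}. 1 + 1 / \<epsilon> i)"
      using that by (simp add: c_def)
    also have "\<dots> \<le> c q"
      unfolding c_def using that eps by (intro sum_mono2) (auto intro!: add_nonneg_nonneg simp: less_imp_le)
    finally show ?thesis by simp
  qed
  have c_large: "1 \<le> c p" "1 / \<epsilon> p \<le> c p" if "p \<ge> 1" for p
  proof -
    have "1 + 1 / \<epsilon> p \<le> c p" "0 < 1 / \<epsilon> p"
      using c_gap[of 0 p] eps[OF that] that by (simp_all add: c_def)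
    then show "1 \<le> c p" "1 / \<epsilon> p \<le> c p"
      by linarith+
  qed
  have c_dist: "1 \<le> \<bar>c p - c q\<bar>" if "p \<noteq> q" "p \<ge> 1" "q \<ge> 1" for p q
  proof -
    have "0 < 1 / \<epsilon> p" "0 < 1 / \<epsilon> q"
      using eps that by simp_all
    then show ?thesis
      using c_gap[of p q] c_gap[of q p] \<open>p \<noteq> q\<close> by linarith
  qed
  \<comment> \<open>The radius 3p is that of a window around one block of radius p that contains every other
    block of this radius meeting it.\<close>
  have "\<exists>\<delta>. p \<ge> 1 \<longrightarrow> 0 < \<delta> \<and> (\<forall>k\<in>{k. \<bar>k\<bar> \<le> 3 * int p}. C * \<delta> \<le> norm (v k) * N (unit_seq k) / 4) \<and>
      4 * C * \<delta> \<le> min 1 (\<epsilon> p)" for p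
  proof (cases "p \<ge> 1")
    case True
    have "{k. \<bar>k\<bar> \<le> 3 * int p} = {- (3 * int p)..3 * int p}"
      by (auto simp: abs_le_iff)
    then have "finite {k. \<bar>k\<bar> \<le> 3 * int p}"
      by simp
    then obtain d where "d > 0"
      and d: "\<forall>k\<in>{k. \<bar>k\<bar> \<le> 3 * int p}. d \<le> norm (v k) * N (unit_seq k) / 4"
      using finite_positive_lower_bound[of "{k. \<bar>k\<bar> \<le> 3 * int p}"
          "\<lambda>k. norm (v k) * N (unit_seq k) / 4"] v_nonzero norm_unit_pos by auto
    define d' where "d' = min d (min 1 (\<epsilon> p) / 4)"
    have "0 < d'" "d' \<le> d" "4 * d' \<le> min 1 (\<epsilon> p)"
      using \<open>d > 0\<close> eps[OF True] by (auto simp: d'_def min_def)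
    then show ?thesis
      using d \<open>C \<ge> 1\<close> by (intro exI[of _ "d' / C"]) force
  qed simp
  then obtain \<delta> where \<delta>_all: "\<forall>p. p \<ge> 1 \<longrightarrow> 0 < \<delta> p \<and>
      (\<forall>k\<in>{k. \<bar>k\<bar> \<le> 3 * int p}. C * \<delta> p \<le> norm (v k) * N (unit_seq k) / 4) \<and>
      4 * C * \<delta> p \<le> min 1 (\<epsilon> p)"
    using choice[of "\<lambda>p \<delta>. p \<ge> 1 \<longrightarrow> 0 < \<delta> \<and>
      (\<forall>k\<in>{k. \<bar>k\<bar> \<le> 3 * int p}. C * \<delta> \<le> norm (v k) * N (unit_seq k) / 4) \<and>
      4 * C * \<delta> \<le> min 1 (\<epsilon> p)"] by blast
  have \<delta>: "0 < \<delta> p" and \<delta>_eps: "4 * C * \<delta> p \<le> min 1 (\<epsilon> p)" if "p \<ge> 1" for p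
    using \<delta>_all that by blast+
  have \<delta>_coord: "C * \<delta> p \<le> norm (v k) * N (unit_seq k) / 4" if "p \<ge> 1" "\<bar>k\<bar> \<le> 3 * int p" for p k
    using \<delta>_all that by blast
  define z where "z p = partial_sum (\<lambda>k. of_real (c p) * v k) {- int p..int p}" for p
  have z: "z p \<in> X" for p
    unfolding z_def by (rule partial_sum_mem)
  define U where "U p = {u \<in> hat_space N. hat_norm N (\<lambda>k. u k - z p k) < \<delta> p}" for p
  define A where "A p = {n. (B ^^ n) y \<in> U p}" for p
  have A_fam: "A p \<in> \<A>" if "p \<ge> 1" for p
  proof -
    have "z p \<in> U p"
      using XC[OF z] \<delta>[OF that] by (simp add: U_def hat.norm_zero)
    then show ?thesis
      unfolding A_def using hat.openin_ball[OF XC[OF z], of p "\<delta> p"] z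
      by (intro hc) (auto simp: U_def)
  qed
  define \<eta> where "\<eta> k = y k / v k" for k
  have orbit: "(B ^^ n) y k = v k * \<eta> (int n + k)" for n k
    by (simp add: B_funpow \<eta>_def add.commute)
  define t where "t p i = (if \<bar>i\<bar> \<le> int p then of_real (c p) else 0 :: 'k)" for p i
  have z_apply: "z p i = v i * t p i" for p i
    by (auto simp: z_def t_def partial_sum_apply abs_le_iff)
  have \<eta>_near: "norm (\<eta> (int n + i) - t p i) < 1/4"
    if n: "n \<in> A p" and p: "p \<ge> 1" and i: "\<bar>i\<bar> \<le> 3 * int p" for n p i
  proof -
    define u where "u = (\<lambda>k. (B ^^ n) y k - z p k)"
    have u: "u \<in> hat_space N" "hat_norm N u < \<delta> p"
      using n XC[OF z] by (auto simp: A_def U_def u_def intro: hat.diff_mem)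
    have "u i = v i * (\<eta> (int n + i) - t p i)"
      by (simp add: u_def orbit z_apply algebra_simps)
    then have "norm (v i) * N (unit_seq i) * norm (\<eta> (int n + i) - t p i) \<le> C * hat_norm N u"
      using coord[OF u(1), of i] by (simp add: norm_mult mult_ac)
    also have "\<dots> < C * \<delta> p"
      using u(2) \<open>C \<ge> 1\<close> by simp
    also have "\<dots> \<le> norm (v i) * N (unit_seq i) * (1/4)"
      using \<delta>_coord[OF p i] by simp
    finally show ?thesis
      using v_nonzero[of i] norm_unit_pos[of i] by (simp add: mult_less_cancel_left_pos)
  qed
  have heights: "norm (t p i - t q i') < 1/2"
    if "n \<in> A p" "m \<in> A q" "p \<ge> 1" "q \<ge> 1" "\<bar>i\<bar> \<le> 3 * int p" "\<bar>i'\<bar> \<le> 3 * int q" "int n + i = int m + i'"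
    for n p i m q i'
    using \<eta>_near[of n p i] \<eta>_near[of m q i'] that
      norm_triangle_ineq4[of "\<eta> (int n + i) - t q i'" "\<eta> (int n + i) - t p i"] by simp
  have same_index: "p = q"
    if "n \<in> A p" "m \<in> A q" "p \<ge> 1" "q \<ge> 1" "\<bar>i\<bar> \<le> int p" "\<bar>i'\<bar> \<le> int q" "int n + i = int m + i'"
    for n p i m q i'
  proof (rule ccontr)
    assume "p \<noteq> q"
    have "norm (of_real (c p - c q) :: 'k) < 1/2"
      using heights[of n p m q i i'] that by (simp add: t_def)
    then show False
      using c_dist[OF \<open>p \<noteq> q\<close> that(3,4)] by (simp only: norm_of_real)
  qed
  \<comment> \<open>A common point of the two plateaus would determine the height, hence the index; two plateaus
    of the same height are excluded by the near-zeros next to each of them.\<close>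
  have blocks_disjoint: "int q < \<bar>int n - int m + j\<bar>"
    if n: "n \<in> A p" and m: "m \<in> A q" and pq: "p \<ge> 1" "q \<ge> 1" and "n \<noteq> m" and j: "\<bar>j\<bar> \<le> int p"
    for n p m q j
  proof (rule ccontr)
    assume "\<not> int q < \<bar>int n - int m + j\<bar>"
    then have "p = q"
      using same_index[OF n m pq j, of "int n - int m + j"] by simp
    have close: "\<bar>int n - int m\<bar> \<le> 2 * int p"
      using \<open>\<not> int q < _\<close> \<open>p = q\<close> j by linarith
    \<comment> \<open>The end of the block at n that is farther from m lies outside the block at m, where
      the iterate at time m is close to 0.\<close>
    define s where "s = (if n > m then int p else - int p)"
    have "norm (t p s - t p (int n - int m + s)) < 1/2"
      using heights[of n p m p s "int n - int m + s"] n m pq(1) close \<open>p = q\<close> \<open>n \<noteq> m\<close>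
      by (auto simp: s_def)
    moreover have "t p s = of_real (c p)" "t p (int n - int m + s) = 0"
      using \<open>n \<noteq> m\<close> pq(1) by (auto simp: t_def s_def)
    ultimately show False
      using c_large(1)[OF pq(1)] by simp
  qed
  have "triple_norm N (shifted_series v (A p) m j) < ennreal (min (\<epsilon> p) (\<epsilon> q))"
    if pq: "p \<ge> 1" "q \<ge> 1" and m: "m \<in> A q" and j: "j \<in> {- int p..int p}" for p q m j
  proof -
    define s where "s = shifted_series v (A p) m j"
    define u where "u = (\<lambda>k. (B ^^ m) y k - z q k)"
    have u: "u \<in> hat_space N" "hat_norm N u < \<delta> q"
      using m XC[OF z] by (auto simp: A_def U_def u_def intro: hat.diff_mem)
    have j': "\<bar>j\<bar> \<le> int p"
      using j by (simp add: abs_le_iff)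
    have cp: "c p > 0"
      using c_large(1)[OF pq(1)] by simp
    have "norm (of_real (c p / 2) * s k) \<le> norm (u k)" for k
    proof (cases "\<exists>n\<in>A p. n \<noteq> m \<and> k = int n - int m + j")
      case True
      then obtain n where n: "n \<in> A p" "n \<noteq> m" "k = int n - int m + j"
        by blast
      have "int q < \<bar>k\<bar>"
        using blocks_disjoint[OF n(1) m pq n(2) j'] n(3) by simp
      then have "u k = v k * \<eta> (int n + j)"
        using n(3) by (simp add: u_def orbit z_apply t_def)
      moreover have "norm (\<eta> (int n + j) - of_real (c p)) < 1/4"
        using \<eta>_near[OF n(1) pq(1), of j] j' by (simp add: t_def)
      then have "c p / 2 \<le> norm (\<eta> (int n + j))"
        using norm_triangle_ineq2[of "of_real (c p)" "\<eta> (int n + j)"] cp c_large(1)[OF pq(1)]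
        by (simp add: norm_minus_commute)
      ultimately have "norm (v k) * (c p / 2) \<le> norm (u k)"
        by (metis mult_left_mono norm_ge_zero norm_mult)
      moreover have "s k = v k"
        using True by (simp add: s_def shifted_series_def)
      ultimately show ?thesis
        using cp by (simp only: norm_mult norm_of_real) (simp add: mult.commute)
    next
      case False
      then have "s k = 0"
        by (auto simp: s_def shifted_series_def)
      then show ?thesis by simp
    qed
    then have cs: "(\<lambda>k. of_real (c p / 2) * s k) \<in> hat_space N"
      "hat_norm N (\<lambda>k. of_real (c p / 2) * s k) \<le> C * hat_norm N u"
      using dom[OF u(1), of "\<lambda>k. of_real (c p / 2) * s k"] by auto
    have "s = (\<lambda>k. of_real (2 / c p) * (of_real (c p / 2) * s k))"
      using cp by simp
    then have s: "s \<in> hat_space N" "hat_norm N s = 2 / c p * hat_norm N (\<lambda>k. of_real (c p / 2) * s k)"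
      using hat.scale_mem[OF cs(1), of "of_real (2 / c p)"] hat.norm_scale[OF cs(1), of "of_real (2 / c p)"] cp
      by (simp_all only: norm_of_real) auto
    have "hat_norm N s \<le> 2 / c p * (C * hat_norm N u)"
      unfolding s(2) using cs(2) cp by (intro mult_left_mono) auto
    also have "\<dots> < 2 / c p * (C * \<delta> q)"
      using u(2) cp \<open>C \<ge> 1\<close> by (intro mult_strict_left_mono) auto
    also have "\<dots> \<le> 2 / c p * (min 1 (\<epsilon> q) / 4)"
      using \<delta>_eps[OF pq(2)] cp by (intro mult_left_mono) auto
    also have "\<dots> \<le> 1 / c p * min 1 (\<epsilon> q)"
      using cp eps[OF pq(2)] by (simp add: divide_simps min_def)
    also have "\<dots> \<le> min (\<epsilon> p) (\<epsilon> q)"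
    proof -
      have "1 / c p \<le> \<epsilon> p" "1 / c p \<le> 1"
        using c_large[OF pq(1)] eps[OF pq(1)] cp by (simp_all add: field_simps)
      then show ?thesis
        using cp eps[OF pq(1)] eps[OF pq(2)] mult_mono[of "1 / c p" "\<epsilon> p" "min 1 (\<epsilon> q)" 1]
          mult_mono[of "1 / c p" 1 "min 1 (\<epsilon> q)" "\<epsilon> q"] by simp
    qed
    finally show ?thesis
      using s(1) unfolding s_def triple_norm_less_iff by simp
  qed
  moreover have "disjoint_family_on A {1..}"
    using same_index[of _ _ _ _ 0 0] unfolding disjoint_family_on_def by fastforce
  ultimately show ?thesis
    unfolding separated_sets_def using A_fam by blast
qed

section \<open>From separated sets to a vector of the enlarged space\<close>

text \<open>
  The vector is assembled from blocks: a copy of the \<open>p\<close>-th target of a dense sequence is put,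
  in coordinates divided by \<open>v\<close>, around every element of \<open>A p\<close>. At a time \<open>m\<close> in \<open>A q\<close> the
  iterate equals the \<open>q\<close>-th target plus a combination of the series for \<open>A p\<close>, \<open>m\<close> and \<open>j\<close>
  whose coefficients depend on \<open>p\<close> and \<open>j\<close> only. For \<open>p \<le> q\<close> the bound \<open>\<epsilon>' q\<close> absorbs these
  coefficients, and for \<open>p > q\<close> the bound \<open>\<epsilon>' p\<close> does, so that the error is at most
  \<open>2 (1/2)\<^sup>q\<close>. The enlarged space is needed since nothing makes the assembled series converge.
\<close>

lemma separated_sets_imp_hypercyclic_for:
  assumes upper: "upper_furstenberg_family \<A> D M AA"
    and null: "positive_null_seq \<epsilon>"
    and sep: "separated_sets \<A> N v (\<lambda>p. {- int p..int p}) \<epsilon>"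
  shows "hypercyclic_for \<A> (hat_space N) (hat_norm N) B X"
proof -
  have "furstenberg_family \<A>" and nonempty: "{} \<notin> \<A>"
    using upper unfolding upper_furstenberg_family_def by - (elim conjE, assumption)+
  then have furst: "A \<in> \<A> \<Longrightarrow> A \<subseteq> A' \<Longrightarrow> A' \<in> \<A>" for A A'
    unfolding furstenberg_family_def by blast
  obtain C where "C \<ge> 1" and C: "\<And>u. u \<in> X \<Longrightarrow> u \<in> hat_space N \<and> hat_norm N u \<le> C * N u"
    using domination by blast
  obtain Z where Z: "countable Z" "Z \<subseteq> X"
    and Z_supp: "\<forall>z\<in>Z. \<exists>L::nat. \<forall>k. \<bar>k\<bar> > int L \<longrightarrow> z k = 0"
    and Z_dense: "\<forall>x\<in>X. \<forall>e>0. \<exists>z\<in>Z. N (\<lambda>k. z k - x k) < e"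
    using countable_dense_finitely_supported by (elim exE conjE)
  have "Z \<noteq> {}"
    using bspec[OF Z_dense zero_mem] zero_less_one by blast
  \<comment> \<open>An enumeration of the dense set that meets each of its elements infinitely often, with
    the p-th term cut down to a sequence supported in \<open>[-p, p]\<close>.\<close>
  define z where "z p = partial_sum (from_nat_into Z (fst (prod_decode p))) {- int p..int p}" for p
  have z_mem: "z p \<in> X" for p
    unfolding z_def by (rule partial_sum_mem)
  have z_supp: "z p k = 0" if "int p < \<bar>k\<bar>" for p k
    using that by (auto simp: z_def partial_sum_apply)
  have z_visits: "\<exists>q\<ge>n. q \<ge> 1 \<and> z q = \<zeta>" if \<zeta>: "\<zeta> \<in> Z" for \<zeta> n
  proof -
    obtain a where a: "from_nat_into Z a = \<zeta>"
      using from_nat_into_surj[OF Z(1) \<zeta>] by (elim exE)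
    obtain L :: nat where L: "\<forall>k. \<bar>k\<bar> > int L \<longrightarrow> \<zeta> k = 0"
      using bspec[OF Z_supp \<zeta>] by (elim exE)
    define q where "q = prod_encode (a, n + L + 1)"
    have q: "n + L + 1 \<le> q"
      unfolding q_def by (rule le_prod_encode_2)
    have "z q k = \<zeta> k" for k
    proof -
      have "fst (prod_decode q) = a"
        by (simp add: q_def)
      moreover have "k \<notin> {- int q..int q} \<Longrightarrow> \<zeta> k = 0"
        using q L[rule_format, of k] by (auto simp: abs_if)
      ultimately show ?thesis
        by (simp add: z_def partial_sum_apply a)
    qed
    then show ?thesis
      using q by (intro exI[of _ q]) auto
  qed
  define c where "c p j = z p j / v j" for p j
  define K where "K p = (\<Sum>j\<in>{- int p..int p}. norm (c p j))" for p
  have K: "0 \<le> K p" for p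
    unfolding K_def by (intro sum_nonneg) simp
  have K1: "0 < 1 + (\<Sum>i\<le>p. K i)" for p
    using sum_nonneg[of "{..p}" K] K by simp
  define \<epsilon>' where "\<epsilon>' p = min (N (unit_seq 0)) ((1/2) ^ p / (1 + (\<Sum>i\<le>p. K i)))" for p
  have \<epsilon>'_pos: "0 < \<epsilon>' p" for p
    using K1[of p] norm_unit_pos[of 0] by (simp add: \<epsilon>'_def)
  have \<epsilon>'_K: "\<epsilon>' p * (\<Sum>i\<le>p. K i) \<le> (1/2) ^ p" for p
  proof -
    have "\<epsilon>' p * (\<Sum>i\<le>p. K i) \<le> \<epsilon>' p * (1 + (\<Sum>i\<le>p. K i))"
      using \<epsilon>'_pos[of p] by (intro mult_left_mono) auto
    also have "\<dots> \<le> (1/2) ^ p / (1 + (\<Sum>i\<le>p. K i)) * (1 + (\<Sum>i\<le>p. K i))"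
      using K1[of p] by (intro mult_right_mono) (auto simp: \<epsilon>'_def)
    also have "\<dots> = (1/2) ^ p"
      using K1[of p] by simp
    finally show ?thesis .
  qed
  \<comment> \<open>Shifts up to 2p instead of p force the blocks of radius p around the elements of the
    p-th set to be disjoint.\<close>
  have "separated_sets \<A> N v (\<lambda>p. {- (2 * int p)..2 * int p}) \<epsilon>'"
    by (rule separated_sets_reindex[OF sep null \<epsilon>'_pos, of 2]) auto
  then obtain A where A: "\<And>p. p \<ge> 1 \<Longrightarrow> A p \<in> \<A>" "disjoint_family_on A {1..}"
    and small: "\<And>p q m j. p \<ge> 1 \<Longrightarrow> q \<ge> 1 \<Longrightarrow> m \<in> A q \<Longrightarrow> j \<in> {- (2 * int p)..2 * int p} \<Longrightarrow>
      triple_norm N (shifted_series v (A p) m j) < ennreal (min (\<epsilon>' p) (\<epsilon>' q))"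
    unfolding separated_sets_def by blast
  define s where "s p m j = shifted_series v (A p) m j" for p m j
  have s: "s p m j \<in> hat_space N" "hat_norm N (s p m j) < min (\<epsilon>' p) (\<epsilon>' q)"
    if "p \<ge> 1" "q \<ge> 1" "m \<in> A q" "\<bar>j\<bar> \<le> 2 * int p" for p q m j
    using small[OF that(1-3), of j] that(4) by (auto simp: s_def triple_norm_less_iff abs_le_iff)
  have far: "2 * int p < \<bar>int n - int m\<bar>"
    if "p \<ge> 1" "q \<ge> 1" "n \<in> A p" "m \<in> A q" "n \<noteq> m" for p q n m
  proof (rule ccontr)
    assume near: "\<not> ?thesis"
    let ?s = "s p m (int m - int n)"
    have "?s 0 = v 0"
      using that by (auto simp: s_def shifted_series_def)
    then have "norm (?s 0) = 1"
      by (simp add: shift_coeff_def)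
    moreover have *: "?s \<in> hat_space N" "hat_norm N ?s < N (unit_seq 0)"
      using s[OF that(1,2,4), of "int m - int n"] near by (auto simp: \<epsilon>'_def)
    moreover have "N (partial_sum ?s {0}) \<le> hat_norm N ?s"
      using interval_sum_le_hat_norm[OF *(1), of 0 0] by simp
    ultimately show False
      by (simp add: norm_partial_sum_singleton)
  qed
  have same: "p = p'" if "p \<ge> 1" "p' \<ge> 1" "n \<in> A p" "n \<in> A p'" for p p' n
    using A(2) that unfolding disjoint_family_on_def by fastforce
  define block where "block k p n \<longleftrightarrow> p \<ge> 1 \<and> n \<in> A p \<and> \<bar>k - int n\<bar> \<le> int p" for k p n
  have unique: "n = n' \<and> p = p'" if "block k p n" "block k p' n'" for k p n p' n'
  proof -
    have "n = n'"
    proof (rule ccontr)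
      assume "n \<noteq> n'"
      then have "2 * int p < \<bar>int n - int n'\<bar>" "2 * int p' < \<bar>int n' - int n\<bar>"
        using far that unfolding block_def by blast+
      then show False
        using that unfolding block_def by linarith
    qed
    then show ?thesis
      using same that unfolding block_def by blast
  qed
  have "\<exists>b. (\<forall>p n. block k p n \<longrightarrow> b = c p (k - int n) * v k) \<and> ((\<forall>p n. \<not> block k p n) \<longrightarrow> b = 0)" for k
  proof (cases "\<exists>p n. block k p n")
    case True
    then obtain p n where "block k p n" by blast
    then show ?thesis
      using unique by (intro exI[of _ "c p (k - int n) * v k"]) blast
  qed blast
  then have "\<forall>k. \<exists>b. (\<forall>p n. block k p n \<longrightarrow> b = c p (k - int n) * v k) \<and> ((\<forall>p n. \<not> block k p n) \<longrightarrow> b = 0)"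
    by (rule allI)
  from choice[OF this] obtain x where x: "\<forall>k. (\<forall>p n. block k p n \<longrightarrow> x k = c p (k - int n) * v k) \<and>
      ((\<forall>p n. \<not> block k p n) \<longrightarrow> x k = 0)"
    by (elim exE)
  have x_block: "x k = c p (k - int n) * v k" if "block k p n" for k p n
    using x that by blast
  have x_0: "x k = 0" if "\<And>p n. \<not> block k p n" for k
    using x that by blast
  have B_x: "(B ^^ m) x k = v k / v (k + int m) * x (k + int m)" for m k
    by (simp add: B_funpow)
  have approx: "(B ^^ m) x \<in> hat_space N \<and> hat_norm N (\<lambda>k. (B ^^ m) x k - z q k) \<le> 2 * (1/2) ^ q"
    if q: "q \<ge> 1" and m: "m \<in> A q" for q m
  proof -
    define u where "u = (\<lambda>k. (B ^^ m) x k - z q k)"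
    have "N (partial_sum u {- int a..int b}) \<le> 2 * (1/2) ^ q" for a b
    proof -
      let ?F = "{- int a..int b}"
      have "finite {p. \<exists>n. block (k + int m) p n}" for k
      proof (cases "\<exists>p n. block (k + int m) p n")
        case True
        then obtain p n where "block (k + int m) p n"
          by blast
        then have "{p. \<exists>n. block (k + int m) p n} \<subseteq> {p}"
          using unique by blast
        then show ?thesis
          by (rule finite_subset) simp
      qed simp
      then have "finite (\<Union>k\<in>?F. {p. \<exists>n. block (k + int m) p n})"
        by (intro finite_UN_I) auto
      then obtain R where R: "\<And>k p n. k \<in> ?F \<Longrightarrow> block (k + int m) p n \<Longrightarrow> p \<le> R"
        unfolding finite_nat_set_iff_bounded_le by blast
      define T where "T = Sigma {1..R} (\<lambda>p. {- int p..int p})"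
      \<comment> \<open>Each coordinate belongs to at most one block, so at most one term on the right does not
        vanish; the block around m itself is the target and contributes no term.\<close>
      have u_eq: "u k = (\<Sum>(p, j)\<in>T. c p j * s p m j k)" if k: "k \<in> ?F" for k
      proof -
        have term_block: "\<exists>n. block (k + int m) p n \<and> n \<noteq> m \<and> j = k + int m - int n"
          if "(p, j) \<in> T" "c p j * s p m j k \<noteq> 0" for p j
        proof -
          have "s p m j k \<noteq> 0"
            using that(2) by auto
          then obtain n where "n \<in> A p" "n \<noteq> m" "k = int n - int m + j"
            unfolding s_def shifted_series_def by (auto split: if_splits)
          then show ?thesis
            using that(1) by (intro exI[of _ n]) (auto simp: block_def T_def)
        qed
        show ?thesis
        proof (cases "\<exists>p n. block (k + int m) p n \<and> n \<noteq> m")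
          case True
          then obtain p n where pn: "block (k + int m) p n" "n \<noteq> m"
            by blast
          define j where "j = k + int m - int n"
          have "\<not> block (k + int m) q m"
            using unique[OF pn(1)] pn(2) by blast
          then have "z q k = 0"
            using q m by (intro z_supp) (simp add: block_def)
          then have "u k = c p j * v k"
            using x_block[OF pn(1)] v_nonzero by (simp add: u_def B_x j_def)
          moreover have "s p m j k = v k"
            using pn by (auto simp: s_def shifted_series_def block_def j_def)
          moreover have "(\<Sum>(p, j)\<in>T. c p j * s p m j k) = (\<Sum>(p, j)\<in>{(p, j)}. c p j * s p m j k)"
          proof (rule sum.mono_neutral_right)
            show "finite T" by (simp add: T_def)
            show "{(p, j)} \<subseteq> T"
              using pn R[OF k pn(1)] by (auto simp: T_def block_def j_def abs_le_iff)
            have "c p' j' * s p' m j' k = 0" if "(p', j') \<in> T" "(p', j') \<noteq> (p, j)" for p' j'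
              using term_block[OF that(1)] that(2) unique[OF pn(1)] j_def by blast
            then show "\<forall>i\<in>T - {(p, j)}. (case i of (p, j) \<Rightarrow> c p j * s p m j k) = 0"
              unfolding case_prod_unfold by (metis DiffE prod.collapse singletonI)
          qed
          ultimately show ?thesis by simp
        next
          case False
          have "u k = 0"
          proof (cases "block (k + int m) q m")
            case True
            then show ?thesis
              using x_block[OF True] v_nonzero by (simp add: u_def B_x c_def)
          next
            case nb: False
            then have "\<not> block (k + int m) p n" for p n
              using False same[OF _ q _ m] unfolding block_def by metis
            then have "x (k + int m) = 0"
              by (rule x_0)
            moreover have "z q k = 0"
              using q m nb by (intro z_supp) (simp add: block_def)
            ultimately show ?thesis
              by (simp add: u_def B_x)
          qed
          moreover have "(\<Sum>(p, j)\<in>T. c p j * s p m j k) = 0"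
          proof (rule sum.neutral, rule ballI)
            fix i assume "i \<in> T"
            then show "(case i of (p, j) \<Rightarrow> c p j * s p m j k) = 0"
              using term_block[of "fst i" "snd i"] False by (auto simp: case_prod_unfold)
          qed
          ultimately show ?thesis by simp
        qed
      qed
      have "partial_sum u ?F = (\<lambda>k. \<Sum>i\<in>T. case i of (p, j) \<Rightarrow> c p j * partial_sum (s p m j) ?F k)"
      proof
        fix k
        have "partial_sum f ?F k = (if k \<in> ?F then f k else 0)" for f :: "int \<Rightarrow> 'k"
          by (rule partial_sum_apply) simp
        then show "partial_sum u ?F k = (\<Sum>i\<in>T. case i of (p, j) \<Rightarrow> c p j * partial_sum (s p m j) ?F k)"
          using u_eq[of k] by (cases "k \<in> ?F") (simp_all add: case_prod_unfold del: atLeastAtMost_iff)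
      qed
      also have "\<dots> = (\<lambda>k. \<Sum>i\<in>T. c (fst i) (snd i) * partial_sum (s (fst i) m (snd i)) ?F k)"
        by (simp add: case_prod_unfold)
      finally have u_sum: "partial_sum u ?F = (\<lambda>k. \<Sum>i\<in>T. c (fst i) (snd i) * partial_sum (s (fst i) m (snd i)) ?F k)" .
      have "N (partial_sum u ?F)
          \<le> (\<Sum>i\<in>T. N (\<lambda>k. c (fst i) (snd i) * partial_sum (s (fst i) m (snd i)) ?F k))"
        unfolding u_sum by (intro norm_sum scale_mem partial_sum_mem)
      also have "\<dots> = (\<Sum>i\<in>T. norm (c (fst i) (snd i)) * N (partial_sum (s (fst i) m (snd i)) ?F))"
        by (simp add: norm_scale[OF partial_sum_mem])
      also have "\<dots> \<le> (\<Sum>i\<in>T. norm (c (fst i) (snd i)) * min (\<epsilon>' (fst i)) (\<epsilon>' q))"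
      proof (intro sum_mono mult_left_mono norm_ge_zero)
        fix i assume "i \<in> T"
        then have i: "fst i \<ge> 1" "\<bar>snd i\<bar> \<le> 2 * int (fst i)"
          by (auto simp: T_def)
        show "N (partial_sum (s (fst i) m (snd i)) ?F) \<le> min (\<epsilon>' (fst i)) (\<epsilon>' q)"
          using interval_sum_le_hat_norm[OF s(1)[OF i(1) q m i(2)], of a b] s(2)[OF i(1) q m i(2)]
          by linarith
      qed
      also have "\<dots> = (\<Sum>p\<in>{1..R}. K p * min (\<epsilon>' p) (\<epsilon>' q))"
        unfolding T_def K_def sum_distrib_right
        by (simp add: sum.Sigma case_prod_unfold)
      also have "\<dots> \<le> (\<Sum>p\<in>{..q} \<union> {q<..R}. K p * min (\<epsilon>' p) (\<epsilon>' q))"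
        using K \<epsilon>'_pos by (intro sum_mono2) (auto simp: less_imp_le)
      also have "\<dots> = (\<Sum>p\<le>q. K p * min (\<epsilon>' p) (\<epsilon>' q)) + (\<Sum>p\<in>{q<..R}. K p * min (\<epsilon>' p) (\<epsilon>' q))"
        by (intro sum.union_disjoint) auto
      also have "\<dots> \<le> (\<Sum>p\<le>q. K p * \<epsilon>' q) + (\<Sum>p\<in>{q<..R}. (1/2) ^ p)"
      proof (intro add_mono sum_mono)
        show "K p * min (\<epsilon>' p) (\<epsilon>' q) \<le> K p * \<epsilon>' q" for p
          using K by (intro mult_left_mono) auto
        fix p
        have "K p * min (\<epsilon>' p) (\<epsilon>' q) \<le> (\<Sum>i\<le>p. K i) * \<epsilon>' p"
          using K \<epsilon>'_pos[of p] \<epsilon>'_pos[of q] member_le_sum[of p "{..p}" K] sum_nonneg[of "{..p}" K]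
          by (intro mult_mono) auto
        then show "K p * min (\<epsilon>' p) (\<epsilon>' q) \<le> (1/2) ^ p"
          using \<epsilon>'_K[of p] by (simp add: mult.commute)
      qed
      also have "\<dots> \<le> (1/2) ^ q + (1/2) ^ q"
        using \<epsilon>'_K[of q] sum_half_powers_le[of q R] by (intro add_mono) (simp_all add: sum_distrib_left mult.commute)
      finally show ?thesis by simp
    qed
    from hat_norm_leI[OF this] have u: "u \<in> hat_space N" "hat_norm N u \<le> 2 * (1/2) ^ q"
      by auto
    have "(B ^^ m) x = (\<lambda>k. u k + z q k)"
      by (simp add: u_def)
    then have "(B ^^ m) x \<in> hat_space N"
      using hat.add_mem[OF u(1)] C[OF z_mem, of q] by simp
    then show ?thesis
      using u(2) by (simp add: u_def)
  qed
  \<comment> \<open>The sequence x need not lie in the enlarged space, but each iterate with index in one of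
    the sets does.\<close>
  obtain m0 where m0: "m0 \<in> A 1"
    using A(1)[of 1] nonempty by (metis ex_in_conv le_refl)
  define y where "y = (B ^^ m0) x"
  have "{n. (B ^^ n) y \<in> U} \<in> \<A>"
    if U: "openin (seq_top (hat_space N) (hat_norm N)) U" and "U \<inter> X \<noteq> {}" for U
  proof -
    obtain u where u: "u \<in> U" "u \<in> X"
      using \<open>U \<inter> X \<noteq> {}\<close> by blast
    obtain r where "r > 0" and r: "\<And>y. y \<in> hat_space N \<Longrightarrow> hat_norm N (\<lambda>n. y n - u n) < r \<Longrightarrow> y \<in> U"
      using U u unfolding hat.openin_iff by blast
    obtain \<zeta> where \<zeta>: "\<zeta> \<in> Z" "N (\<lambda>k. \<zeta> k - u k) < r / (2 * C)"
      using bspec[OF Z_dense u(2)] \<open>r > 0\<close> \<open>C \<ge> 1\<close> by (metis divide_pos_pos less_le_trans mult_pos_pos zero_less_numeral zero_less_one)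
    have \<zeta>X: "\<zeta> \<in> X"
      using \<zeta>(1) Z(2) by blast
    have "hat_norm N (\<lambda>k. \<zeta> k - u k) \<le> C * N (\<lambda>k. \<zeta> k - u k)"
      using C[OF diff_mem[OF \<zeta>X u(2)]] by blast
    also have "\<dots> < r / 2"
      using \<zeta>(2) \<open>C \<ge> 1\<close> by (simp add: field_simps)
    finally have \<zeta>u: "hat_norm N (\<lambda>k. \<zeta> k - u k) < r / 2" .
    have lim: "(\<lambda>q. 2 * (1/2 :: real) ^ q) \<longlonglongrightarrow> 0"
      by (rule tendsto_mult_right_zero[OF LIMSEQ_power_zero]) simp
    have "\<forall>\<^sub>F q in sequentially. 2 * (1/2) ^ q < r / 2"
      using order_tendstoD(2)[OF lim, of "r / 2"] \<open>r > 0\<close> by simp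
    then obtain n0 where n0: "\<And>q. q \<ge> n0 \<Longrightarrow> 2 * (1/2) ^ q < r / 2"
      by (auto simp: eventually_sequentially)
    obtain q where q: "q \<ge> n0" "q \<ge> 1" "z q = \<zeta>"
      using z_visits[OF \<zeta>(1)] by blast
    have "(B ^^ m) x \<in> U" if "m \<in> A q" for m
    proof (rule r)
      show mem: "(B ^^ m) x \<in> hat_space N"
        using approx[OF q(2) that] by simp
      show "hat_norm N (\<lambda>n. (B ^^ m) x n - u n) < r"
        using hat.norm_triangle[of "(B ^^ m) x" \<zeta> u] mem C \<zeta>X u(2) \<zeta>u approx[OF q(2) that] n0[OF q(1)] q(3)
        by fastforce
    qed
    moreover have "(B ^^ n) y = (B ^^ (n + m0)) x" for n
      by (simp add: y_def funpow_add)
    ultimately have "{k. k + m0 \<in> A q} \<subseteq> {n. (B ^^ n) y \<in> U}"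
      by auto
    then show ?thesis
      using furst upper_furstenberg_family_translate[OF upper A(1)[OF q(2)]] by blast
  qed
  moreover have "y \<in> hat_space N"
    using approx[of 1, OF _ m0] by (simp add: y_def)
  ultimately show ?thesis
    unfolding hypercyclic_for_def by blast
qed

section \<open>Back to the original space\<close>

text \<open>
  In an upper family, the times at which the orbit of \<open>y\<close> enters a ball around a target lie,
  together with all their translates, in one \<open>\<Inter>\<mu>\<in>M. AA \<delta> \<mu>\<close>, with \<open>\<delta>\<close> depending on the ball
  alone. Membership of a set of times in \<open>AA \<delta> \<mu>\<close> is settled by finitely many of them. Hence
  the vectors of the space whose return times to the ball belong to \<open>AA \<delta> \<mu>\<close> form an open set.
  It is dense, because iterates of \<open>y\<close> approximate every vector of the space and may be replaced
  by long truncations. Baire's theorem provides a vector that serves all balls with a radius from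
  a null sequence around the elements of a countable dense set, and all \<open>\<mu>\<close>, at once.
\<close>

lemma hypercyclic_for_imp_hypercyclic:
  assumes upper: "upper_furstenberg_family \<A> D M AA"
    and hyp: "hypercyclic_for \<A> (hat_space N) (hat_norm N) B X"
  shows "hypercyclic \<A> X N B"
proof -
  have "furstenberg_family \<A>" and nonempty: "{} \<notin> \<A>" and "countable M"
    and \<A>_eq: "\<A> = (\<Union>\<delta>\<in>D. \<Inter>\<mu>\<in>M. AA \<delta> \<mu>)"
    and finitary: "\<forall>\<delta>\<in>D. \<forall>\<mu>\<in>M. \<forall>A\<in>AA \<delta> \<mu>. \<exists>F. finite F \<and> (\<forall>B. A \<inter> F \<subseteq> B \<longrightarrow> B \<in> AA \<delta> \<mu>)"
    and translates: "\<forall>A\<in>\<A>. \<exists>\<delta>\<in>D. \<forall>n. {k. k + n \<in> A} \<in> (\<Inter>\<mu>\<in>M. AA \<delta> \<mu>)"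
    using upper unfolding upper_furstenberg_family_def by - (elim conjE, assumption)+
  then have furst: "A \<in> \<A> \<Longrightarrow> A \<subseteq> A' \<Longrightarrow> A' \<in> \<A>" for A A'
    unfolding furstenberg_family_def by blast
  obtain C where "C \<ge> 1" and C: "\<And>u. u \<in> X \<Longrightarrow> u \<in> hat_space N \<and> hat_norm N u \<le> C * N u"
    using domination by blast
  obtain Z where Z: "countable Z" "Z \<subseteq> X"
    and Z_supp: "\<forall>z\<in>Z. \<exists>L::nat. \<forall>k. \<bar>k\<bar> > int L \<longrightarrow> z k = 0"
    and Z_dense: "\<forall>x\<in>X. \<forall>e>0. \<exists>z\<in>Z. N (\<lambda>k. z k - x k) < e"
    using countable_dense_finitely_supported by (elim exE conjE)
  obtain y where y: "y \<in> hat_space N"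
    and hc: "\<forall>U. openin (seq_top (hat_space N) (hat_norm N)) U \<and> U \<inter> X \<noteq> {} \<longrightarrow>
      {n. (B ^^ n) y \<in> U} \<in> \<A>"
    using hyp unfolding hypercyclic_for_def by (elim bexE)
  define V where "V z r = {u \<in> hat_space N. hat_norm N (\<lambda>k. u k - z k) < r}" for z r
  have V_returns: "{n. (B ^^ n) y \<in> V z r} \<in> \<A>" if z: "z \<in> X" and "0 < r" for z r
  proof -
    have zh: "z \<in> hat_space N"
      using C[OF z] by simp
    have "openin (seq_top (hat_space N) (hat_norm N)) (V z r)"
      unfolding V_def by (rule hat.openin_ball[OF zh])
    moreover have "z \<in> V z r \<inter> X"
      using zh z \<open>0 < r\<close> by (simp add: V_def hat.norm_zero)
    ultimately show ?thesis
      using hc by blast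
  qed
  define e where "e i = inverse (real (Suc i))" for i
  have e_pos: "e i > 0" for i
    by (simp add: e_def)
  define Ret where "Ret z i = {n. (B ^^ n) y \<in> V z (e i)}" for z i
  have "\<exists>\<delta>. z \<in> X \<longrightarrow> \<delta> \<in> D \<and> (\<forall>n. {k. k + n \<in> Ret z i} \<in> (\<Inter>\<mu>\<in>M. AA \<delta> \<mu>))" for z i
    using bspec[OF translates V_returns[of z "e i"]] e_pos unfolding Ret_def by blast
  then have "\<forall>zi. \<exists>\<delta>. fst zi \<in> X \<longrightarrow>
      \<delta> \<in> D \<and> (\<forall>n. {k. k + n \<in> Ret (fst zi) (snd zi)} \<in> (\<Inter>\<mu>\<in>M. AA \<delta> \<mu>))"
    by (intro allI)
  from choice[OF this] obtain \<delta> where \<delta>0: "\<forall>zi. fst zi \<in> X \<longrightarrow>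
      \<delta> zi \<in> D \<and> (\<forall>n. {k. k + n \<in> Ret (fst zi) (snd zi)} \<in> (\<Inter>\<mu>\<in>M. AA (\<delta> zi) \<mu>))"
    by (elim exE)
  have \<delta>_D: "\<delta> (z, i) \<in> D" if "z \<in> X" for z i
    using \<delta>0[rule_format, of "(z, i)"] that by simp
  have \<delta>_ret: "{k. k + n \<in> Ret z i} \<in> AA (\<delta> (z, i)) \<mu>" if "z \<in> X" "\<mu> \<in> M" for z i n \<mu>
    using \<delta>0[rule_format, of "(z, i)"] that by simp
  define S where "S x z i = {n. N (\<lambda>k. (B ^^ n) x k - z k) < e i}" for x z i
  define G where "G t = {x \<in> X. S x (fst t) (fst (snd t)) \<in> AA (\<delta> (fst t, fst (snd t))) (snd (snd t))}"
    for t
  obtain b where "b > 0" and b: "\<forall>x\<in>X. N (B x) \<le> b * N x"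
    using operator_bounded[OF shift_operator] by blast
  have b_pow: "N ((B ^^ n) x) \<le> b ^ n * N x" if "x \<in> X" for n x
  proof (induction n)
    case (Suc n)
    have "N (B ((B ^^ n) x)) \<le> b * N ((B ^^ n) x)"
      using b B_funpow_mem[OF that] by simp
    also have "\<dots> \<le> b * (b ^ n * N x)"
      using Suc \<open>b > 0\<close> by simp
    finally show ?case by (simp add: mult.assoc)
  qed simp
  have "\<exists>x\<in>X. \<forall>t\<in>Z \<times> UNIV \<times> M. x \<in> G t"
  proof (rule Baire_balls[OF mcomplete, where G = G])
    show "countable (Z \<times> (UNIV :: nat set) \<times> M)"
      using Z(1) \<open>countable M\<close> by simp
    show "G t \<subseteq> X" for t
      by (auto simp: G_def)
  next
    fix t x assume t: "t \<in> Z \<times> (UNIV :: nat set) \<times> M" and x: "x \<in> G t"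
    obtain z i \<mu> where t_eq: "t = (z, i, \<mu>)" and z: "z \<in> X" and \<mu>: "\<mu> \<in> M"
      using t Z(2) by (cases t) auto
    have xX: "x \<in> X" and S: "S x z i \<in> AA (\<delta> (z, i)) \<mu>"
      using x by (simp_all add: G_def t_eq)
    obtain F where F: "finite F" "\<forall>B. S x z i \<inter> F \<subseteq> B \<longrightarrow> B \<in> AA (\<delta> (z, i)) \<mu>"
      using bspec[OF bspec[OF bspec[OF finitary \<delta>_D[OF z]] \<mu>] S] by (elim exE conjE)
    obtain r where "r > 0"
      and r: "\<forall>n\<in>S x z i \<inter> F. r \<le> (e i - N (\<lambda>k. (B ^^ n) x k - z k)) / b ^ n"
      using finite_positive_lower_bound[of "S x z i \<inter> F" "\<lambda>n. (e i - N (\<lambda>k. (B ^^ n) x k - z k)) / b ^ n"]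
        F(1) \<open>b > 0\<close> by (auto simp: S_def)
    have "x' \<in> G t" if x': "x' \<in> X" and lt: "N (\<lambda>n. x' n - x n) < r" for x'
    proof -
      have "n \<in> S x' z i" if n: "n \<in> S x z i \<inter> F" for n
      proof -
        have "N (\<lambda>k. (B ^^ n) x' k - (B ^^ n) x k) \<le> b ^ n * N (\<lambda>k. x' k - x k)"
          using b_pow[OF diff_mem[OF x' xX]] by (simp add: B_funpow_diff)
        also have "\<dots> < b ^ n * r"
          using lt \<open>b > 0\<close> by simp
        also have "\<dots> \<le> e i - N (\<lambda>k. (B ^^ n) x k - z k)"
          using bspec[OF r n] \<open>b > 0\<close> by (simp add: pos_le_divide_eq mult.commute)
        finally have "N (\<lambda>k. (B ^^ n) x' k - (B ^^ n) x k) + N (\<lambda>k. (B ^^ n) x k - z k) < e i"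
          by simp
        then show ?thesis
          using norm_triangle[OF B_funpow_mem[OF x'] B_funpow_mem[OF xX] z, of n n] by (simp add: S_def)
      qed
      then have "S x' z i \<in> AA (\<delta> (z, i)) \<mu>"
        using F(2) by blast
      then show ?thesis
        using x' by (simp add: G_def t_eq)
    qed
    then show "\<exists>r>0. \<forall>y\<in>X. N (\<lambda>n. y n - x n) < r \<longrightarrow> y \<in> G t"
      using \<open>r > 0\<close> by blast
  next
    fix t x and r :: real
    assume t: "t \<in> Z \<times> (UNIV :: nat set) \<times> M" and x: "x \<in> X" and "0 < r"
    obtain z i \<mu> where t_eq: "t = (z, i, \<mu>)" and zZ: "z \<in> Z" and z: "z \<in> X" and \<mu>: "\<mu> \<in> M"
      using t Z(2) by (cases t) auto
    obtain z' where z'Z: "z' \<in> Z" and z'x: "N (\<lambda>k. z' k - x k) < r / 2"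
      using bspec[OF Z_dense x] \<open>0 < r\<close> half_gt_zero by blast
    have z': "z' \<in> X"
      using z'Z Z(2) by blast
    have "{n. (B ^^ n) y \<in> V z' (r / 2)} \<noteq> {}"
      using V_returns[OF z', of "r / 2"] \<open>0 < r\<close> nonempty by (metis half_gt_zero)
    then obtain n where n: "(B ^^ n) y \<in> V z' (r / 2)"
      by blast
    define y' where "y' = (B ^^ n) y"
    have y': "y' \<in> hat_space N" "hat_norm N (\<lambda>k. y' k - z' k) < r / 2"
      using n by (auto simp: y'_def V_def)
    obtain F where F: "finite F" "\<forall>B. {k. k + n \<in> Ret z i} \<inter> F \<subseteq> B \<longrightarrow> B \<in> AA (\<delta> (z, i)) \<mu>"
      using bspec[OF bspec[OF bspec[OF finitary \<delta>_D[OF z]] \<mu>] \<delta>_ret[OF z \<mu>, of n i]] by (elim exE conjE)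
    obtain L1 L2 :: nat where L1: "\<forall>k. \<bar>k\<bar> > int L1 \<longrightarrow> z k = 0" and L2: "\<forall>k. \<bar>k\<bar> > int L2 \<longrightarrow> z' k = 0"
      using bspec[OF Z_supp zZ] bspec[OF Z_supp z'Z] by (elim exE)
    define L where "L = L1 + L2 + (\<Sum>k\<in>F. k)"
    have FL: "k + L1 \<le> L" if "k \<in> F" for k
      using member_le_sum[of k F "\<lambda>k. k"] that F(1) by (simp add: L_def)
    define x' where "x' = partial_sum y' {- int L..int L}"
    have x': "x' \<in> X"
      unfolding x'_def by (rule partial_sum_mem)
    have "z' k = 0" if "k \<notin> {- int L..int L}" for k
    proof -
      have "L2 \<le> L"
        by (simp add: L_def)
      then show ?thesis
        using L2 that by (auto simp: abs_if)
    qed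
    then have "(\<lambda>k. x' k - z' k) = partial_sum (\<lambda>k. y' k - z' k) {- int L..int L}"
      by (auto simp: x'_def partial_sum_apply fun_eq_iff)
    then have "N (\<lambda>k. x' k - z' k) \<le> hat_norm N (\<lambda>k. y' k - z' k)"
      using interval_sum_le_hat_norm[OF hat.diff_mem[OF y'(1)], of z' L L] C[OF z'] by simp
    then have "N (\<lambda>k. x' k - x k) < r"
      using norm_triangle[OF x' z' x] y'(2) z'x by simp
    \<comment> \<open>Truncation commutes with the shift up to a translation of the window, which still
      contains 0 and the support of z for the finitely many iterates that matter.\<close>
    have "k \<in> S x' z i" if k: "k \<in> {k. k + n \<in> Ret z i} \<inter> F" for k
    proof -
      have By: "(B ^^ k) y' \<in> hat_space N" "hat_norm N (\<lambda>l. (B ^^ k) y' l - z l) < e i"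
        using k by (simp_all add: Ret_def V_def y'_def funpow_add)
      have "(\<lambda>l. (B ^^ k) x' l - z l) = partial_sum (\<lambda>l. (B ^^ k) y' l - z l) {- int (L + k)..int (L - k)}"
        using L1 FL[of k] k by (auto simp: x'_def B_funpow partial_sum_apply fun_eq_iff)
      then have "N (\<lambda>l. (B ^^ k) x' l - z l) \<le> hat_norm N (\<lambda>l. (B ^^ k) y' l - z l)"
        using interval_sum_le_hat_norm[OF hat.diff_mem[OF By(1)], of z "L + k" "L - k"] C[OF z] by simp
      then show ?thesis
        using By(2) by (simp add: S_def)
    qed
    then have "S x' z i \<in> AA (\<delta> (z, i)) \<mu>"
      using F(2) by blast
    then have "x' \<in> G t"
      using x' by (simp add: G_def t_eq)
    then show "\<exists>y\<in>G t. N (\<lambda>n. y n - x n) < r"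
      using \<open>N (\<lambda>k. x' k - x k) < r\<close> by blast
  qed
  then obtain x where x: "x \<in> X" and xG: "\<forall>t\<in>Z \<times> UNIV \<times> M. x \<in> G t"
    by (elim bexE)
  have S_fam: "S x z i \<in> \<A>" if z: "z \<in> Z" for z i
  proof -
    have "S x z i \<in> (\<Inter>\<mu>\<in>M. AA (\<delta> (z, i)) \<mu>)"
      using xG z by (auto simp: G_def)
    moreover have "\<delta> (z, i) \<in> D"
      using \<delta>_D z Z(2) by blast
    ultimately show ?thesis
      by (subst \<A>_eq) (rule UN_I)
  qed
  have "{n. (B ^^ n) x \<in> U} \<in> \<A>" if U: "openin (seq_top X N) U" "U \<noteq> {}" for U
  proof -
    obtain u where u: "u \<in> U" "u \<in> X"
      using U unfolding openin_iff by blast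
    obtain r where "r > 0" and r: "\<forall>y\<in>X. N (\<lambda>n. y n - u n) < r \<longrightarrow> y \<in> U"
      using U(1) u unfolding openin_iff by blast
    obtain z where z: "z \<in> Z" and zu: "N (\<lambda>k. z k - u k) < r / 2"
      using bspec[OF Z_dense u(2)] \<open>0 < r\<close> half_gt_zero by blast
    have zX: "z \<in> X"
      using z Z(2) by blast
    obtain i where i: "e i < r / 2"
      using reals_Archimedean[of "r / 2"] \<open>r > 0\<close> by (auto simp: e_def)
    have "(B ^^ n) x \<in> U" if n: "n \<in> S x z i" for n
    proof -
      have "N (\<lambda>k. (B ^^ n) x k - u k) < r"
        using norm_triangle[OF B_funpow_mem[OF x] zX u(2), of n] zu i n by (simp add: S_def)
      then show ?thesis
        using r B_funpow_mem[OF x] by blast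
    qed
    then have "S x z i \<subseteq> {n. (B ^^ n) x \<in> U}"
      by blast
    then show ?thesis
      using furst[OF S_fam[OF z]] by blast
  qed
  then show ?thesis
    unfolding hypercyclic_def using x by blast
qed

section \<open>Invertible shifts\<close>

lemma weighted_shift_partial_sum:
  assumes "finite F"
  shows "B (partial_sum x F) = partial_sum (B x) ((\<lambda>k. k - 1) ` F)"
proof
  fix k
  have "k \<in> (\<lambda>k. k - 1) ` F \<longleftrightarrow> k + 1 \<in> F"
    by force
  then show "B (partial_sum x F) k = partial_sum (B x) ((\<lambda>k. k - 1) ` F) k"
    using assms by (simp add: partial_sum_apply weighted_shift_def)
qed

text \<open>
  The shift moves the series for \<open>j\<close> to the one for \<open>j - 1\<close>, so changing \<open>j\<close> by one multiplies the
  norm by at most the norm of the shift or of its inverse. Arbitrary finite truncations are used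
  because the shift displaces the window of a truncation.
\<close>

lemma invertible_series_growth:
  assumes inv: "invertible_on X N B"
  shows "\<exists>K\<ge>1. \<forall>A m b. (\<forall>F. finite F \<longrightarrow> N (partial_sum (shifted_series v A m 0) F) \<le> b) \<longrightarrow>
    (\<forall>j F. finite F \<longrightarrow> N (partial_sum (shifted_series v A m j) F) \<le> K ^ nat \<bar>j\<bar> * b)"
proof -
  obtain R where R: "operator_on X N R" "\<And>x. x \<in> X \<Longrightarrow> R (B x) = x"
    using inv unfolding invertible_on_def by blast
  obtain b1 where b1: "\<And>x. x \<in> X \<Longrightarrow> N (B x) \<le> b1 * N x"
    using operator_bounded[OF shift_operator] by blast
  obtain b2 where b2: "\<And>x. x \<in> X \<Longrightarrow> N (R x) \<le> b2 * N x"
    using operator_bounded[OF R(1)] by blast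
  define K where "K = max 1 (max b1 b2)"
  have K: "K \<ge> 1" "b1 \<le> K" "b2 \<le> K"
    by (auto simp: K_def)
  have step: "N (B x) \<le> K * N x" "N x \<le> K * N (B x)" if x: "x \<in> X" for x
  proof -
    have Bx: "B x \<in> X"
      using shift_operator x by (simp add: operator_on_def)
    show "N (B x) \<le> K * N x"
      using b1[OF x] K(2) norm_nonneg[OF x] mult_right_mono order_trans by blast
    have "N x \<le> b2 * N (B x)"
      using b2[OF Bx] R(2)[OF x] by simp
    then show "N x \<le> K * N (B x)"
      using K(3) norm_nonneg[OF Bx] mult_right_mono order_trans by blast
  qed
  have shift: "N (partial_sum (shifted_series v A m (j - 1)) ((\<lambda>k. k - 1) ` F))
        \<le> K * N (partial_sum (shifted_series v A m j) F)"
      "N (partial_sum (shifted_series v A m j) F)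
        \<le> K * N (partial_sum (shifted_series v A m (j - 1)) ((\<lambda>k. k - 1) ` F))"
    if "finite F" for A m j F
    using step[OF partial_sum_mem[of "shifted_series v A m j" F]]
      weighted_shift_partial_sum[OF that, of "shifted_series v A m j"]
      weighted_shift_shifted_series[of w A m j, OF w] by simp_all
  have "N (partial_sum (shifted_series v A m j) F) \<le> K ^ nat \<bar>j\<bar> * b"
    if b: "\<And>F. finite F \<Longrightarrow> N (partial_sum (shifted_series v A m 0) F) \<le> b" and "finite F" for A m b j F
  proof -
    have "\<forall>F. finite F \<longrightarrow> N (partial_sum (shifted_series v A m (- int n)) F) \<le> K ^ n * b" for n
    proof (induction n)
      case (Suc n)
      show ?case
      proof (intro allI impI)
        fix F :: "int set" assume F: "finite F"
        have F': "F = (\<lambda>k. k - 1) ` (\<lambda>k. k + 1) ` F"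
          by (simp add: image_image)
        have eq: "- int (Suc n) = - int n - 1"
          by simp
        have "N (partial_sum (shifted_series v A m (- int n - 1)) F)
            \<le> K * N (partial_sum (shifted_series v A m (- int n)) ((\<lambda>k. k + 1) ` F))"
          using shift(1)[of "(\<lambda>k. k + 1) ` F" A m "- int n"] F F' by simp
        also have "\<dots> \<le> K * (K ^ n * b)"
          using Suc F K(1) by (intro mult_left_mono) auto
        finally show "N (partial_sum (shifted_series v A m (- int (Suc n))) F) \<le> K ^ Suc n * b"
          unfolding eq by (simp add: mult.assoc)
      qed
    qed (use b in simp)
    moreover have "\<forall>F. finite F \<longrightarrow> N (partial_sum (shifted_series v A m (int n)) F) \<le> K ^ n * b" for n
    proof (induction n)
      case (Suc n)
      show ?case
      proof (intro allI impI)
        fix F :: "int set" assume F: "finite F"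
        have "N (partial_sum (shifted_series v A m (int (Suc n))) F)
            \<le> K * N (partial_sum (shifted_series v A m (int n)) ((\<lambda>k. k - 1) ` F))"
          using shift(2)[OF F, of A m "int (Suc n)"] by simp
        also have "\<dots> \<le> K * (K ^ n * b)"
          using Suc F K(1) by (intro mult_left_mono) auto
        finally show "N (partial_sum (shifted_series v A m (int (Suc n))) F) \<le> K ^ Suc n * b"
          by (simp add: mult.assoc)
      qed
    qed (use b in simp)
    ultimately show ?thesis
      using \<open>finite F\<close> by (cases j rule: int_cases2) auto
  qed
  then show ?thesis
    using K(1) by blast
qed

text \<open>
  The growth factor \<open>K ^ p\<close> for \<open>\<bar>j\<bar> \<le> p\<close> is compensated by bounds that decay faster than
  \<open>K ^ - p\<close>. If \<open>p < q\<close>, then \<open>K ^ p \<le> K ^ q\<close> is still compensated by the bound at \<open>q\<close>.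
\<close>

lemma invertible_separated_sets:
  assumes inv: "invertible_on X N B"
    and null: "positive_null_seq \<epsilon>" and sep: "separated_sets \<A> N v (\<lambda>p. {0}) \<epsilon>"
  shows "separated_sets \<A> N v (\<lambda>p. {- int p..int p}) (\<lambda>p. (1/2) ^ p)"
proof -
  obtain C where "C \<ge> 1"
    and fin: "\<And>u F. u \<in> hat_space N \<Longrightarrow> finite F \<Longrightarrow> N (partial_sum u F) \<le> C * hat_norm N u"
    using domination by (elim exE conjE) auto
  obtain K where "K \<ge> 1"
    and K: "\<forall>A m b. (\<forall>F. finite F \<longrightarrow> N (partial_sum (shifted_series v A m 0) F) \<le> b) \<longrightarrow>
      (\<forall>j F. finite F \<longrightarrow> N (partial_sum (shifted_series v A m j) F) \<le> K ^ nat \<bar>j\<bar> * b)"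
    using invertible_series_growth[OF inv] by (elim exE conjE)
  define \<epsilon>' where "\<epsilon>' p = (1/2) ^ p / (C * K ^ p)" for p :: nat
  have \<epsilon>'_pos: "0 < \<epsilon>' p" for p
    using \<open>C \<ge> 1\<close> \<open>K \<ge> 1\<close> by (simp add: \<epsilon>'_def)
  have \<epsilon>'_eq: "K ^ p * (C * \<epsilon>' p) = (1/2) ^ p" for p
    using \<open>C \<ge> 1\<close> \<open>K \<ge> 1\<close> by (simp add: \<epsilon>'_def)
  have "separated_sets \<A> N v (\<lambda>p. {0}) \<epsilon>'"
    by (rule separated_sets_reindex[OF sep null \<epsilon>'_pos, of 0]) simp
  then obtain A where A: "\<forall>p\<ge>1. A p \<in> \<A>" "disjoint_family_on A {1..}"
    and small: "\<forall>p\<ge>1. \<forall>q\<ge>1. \<forall>m\<in>A q. \<forall>j\<in>{0}.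
      triple_norm N (shifted_series v (A p) m j) < ennreal (min (\<epsilon>' p) (\<epsilon>' q))"
    unfolding separated_sets_def by (elim exE conjE)
  have "triple_norm N (shifted_series v (A p) m j) < ennreal (min ((1/2) ^ p) ((1/2) ^ q))"
    if pq: "p \<ge> 1" "q \<ge> 1" and m: "m \<in> A q" and j: "j \<in> {- int p..int p}" for p q m j
  proof -
    define s where "s = shifted_series v (A p) m"
    have s0: "s 0 \<in> hat_space N" "hat_norm N (s 0) < min (\<epsilon>' p) (\<epsilon>' q)"
      using small pq m by (auto simp: triple_norm_less_iff s_def)
    have bound: "N (partial_sum (s j) F) \<le> K ^ nat \<bar>j\<bar> * (C * hat_norm N (s 0))" if "finite F" for F
      using K[rule_format, OF _ that, of "A p" m "C * hat_norm N (s 0)" j] fin[OF s0(1)]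
      unfolding s_def by blast
    have sj: "s j \<in> hat_space N" "hat_norm N (s j) \<le> K ^ nat \<bar>j\<bar> * (C * hat_norm N (s 0))"
      using hat_norm_leI[OF bound] by auto
    note sj(2)
    also have "K ^ nat \<bar>j\<bar> * (C * hat_norm N (s 0)) \<le> K ^ p * (C * hat_norm N (s 0))"
      using \<open>K \<ge> 1\<close> \<open>C \<ge> 1\<close> j hat_norm_nonneg[of "s 0"]
      by (intro mult_right_mono power_increasing) auto
    also have "\<dots> \<le> K ^ max p q * (C * hat_norm N (s 0))"
      using \<open>K \<ge> 1\<close> \<open>C \<ge> 1\<close> hat_norm_nonneg[of "s 0"]
      by (intro mult_right_mono power_increasing) auto
    also have "\<dots> < K ^ max p q * (C * \<epsilon>' (max p q))"
      using s0(2) \<open>K \<ge> 1\<close> \<open>C \<ge> 1\<close> by (intro mult_strict_left_mono) (auto simp: max_def)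
    also have "\<dots> = min ((1/2) ^ p) ((1/2) ^ q)"
      unfolding \<epsilon>'_eq by (auto simp: max_def min_def power_decreasing intro: antisym)
    finally show ?thesis
      using sj(1) by (simp add: triple_norm_less_iff s_def)
  qed
  then show ?thesis
    unfolding separated_sets_def using A by (intro exI[of _ A]) simp
qed

end

section \<open>The equivalences\<close>

theorem theorem11:
  fixes X :: "(int \<Rightarrow> 'k::{real_normed_field, euclidean_space}) set"
    and N :: "(int \<Rightarrow> 'k) \<Rightarrow> real"
    and w :: "int \<Rightarrow> 'k"
    and \<A> :: "nat set set"
    and D :: "'d set" and M :: "'m set" and AA :: "'d \<Rightarrow> 'm \<Rightarrow> nat set set"
  assumes "banach_sequence_space X N"
    and "unconditional_unit_basis X N"
    and "\<And>n. w n \<noteq> 0"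
    and "operator_on X N (weighted_shift w)"
    and "upper_furstenberg_family \<A> D M AA"
  shows "((\<exists>\<epsilon>. positive_null_seq \<epsilon> \<and>
              separated_sets \<A> N (shift_coeff w) (\<lambda>p. {- int p..int p}) \<epsilon>)
           \<longleftrightarrow> hypercyclic \<A> X N (weighted_shift w)) \<and>
         ((\<forall>\<epsilon>. positive_null_seq \<epsilon> \<longrightarrow>
              separated_sets \<A> N (shift_coeff w) (\<lambda>p. {- int p..int p}) \<epsilon>)
           \<longleftrightarrow> hypercyclic \<A> X N (weighted_shift w)) \<and>
         (hypercyclic_for \<A> (hat_space N) (hat_norm N) (weighted_shift w) X
           \<longleftrightarrow> hypercyclic \<A> X N (weighted_shift w)) \<and>
         (invertible_on X N (weighted_shift w) \<longrightarrow>
           ((\<exists>\<epsilon>. positive_null_seq \<epsilon> \<and>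
                separated_sets \<A> N (shift_coeff w) (\<lambda>p. {0}) \<epsilon>)
             \<longleftrightarrow> hypercyclic \<A> X N (weighted_shift w)) \<and>
           ((\<forall>\<epsilon>. positive_null_seq \<epsilon> \<longrightarrow>
                separated_sets \<A> N (shift_coeff w) (\<lambda>p. {0}) \<epsilon>)
             \<longleftrightarrow> hypercyclic \<A> X N (weighted_shift w)))"
proof -
  interpret weighted_shift_space X N w
    by unfold_locales (rule assms)+
  let ?H = "hypercyclic \<A> X N (weighted_shift w)"
  let ?for = "hypercyclic_for \<A> (hat_space N) (hat_norm N) (weighted_shift w) X"
  let ?sep = "separated_sets \<A> N (shift_coeff w) (\<lambda>p. {- int p..int p})"
  let ?single = "separated_sets \<A> N (shift_coeff w) (\<lambda>p. {0})"
  let ?half = "\<lambda>p. (1/2 :: real) ^ p"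
  have furst: "furstenberg_family \<A>"
    using assms(5) unfolding upper_furstenberg_family_def by - (elim conjE, assumption)
  have H_for: "?H \<Longrightarrow> ?for"
    by (rule hypercyclic_imp_hypercyclic_for[OF furst])
  have for_sep: "?for \<Longrightarrow> positive_null_seq \<epsilon> \<Longrightarrow> ?sep \<epsilon>" for \<epsilon>
    by (rule hypercyclic_for_imp_separated_sets[OF furst]) (auto simp: positive_null_seq_def)
  have sep_for: "positive_null_seq \<epsilon> \<Longrightarrow> ?sep \<epsilon> \<Longrightarrow> ?for" for \<epsilon>
    by (rule separated_sets_imp_hypercyclic_for[OF assms(5)])
  have for_H: "?for \<Longrightarrow> ?H"
    by (rule hypercyclic_for_imp_hypercyclic[OF assms(5)])
  have sep_single: "?sep \<epsilon> \<Longrightarrow> ?single \<epsilon>" for \<epsilon>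
    by (rule separated_sets_anti_mono) auto
  have single_sep: "invertible_on X N (weighted_shift w) \<Longrightarrow> positive_null_seq \<epsilon> \<Longrightarrow> ?single \<epsilon> \<Longrightarrow> ?sep ?half" for \<epsilon>
    by (rule invertible_separated_sets)
  have half: "positive_null_seq ?half"
    by (rule positive_null_seq_half_powers)
  have 1: "(\<exists>\<epsilon>. positive_null_seq \<epsilon> \<and> ?sep \<epsilon>) \<longleftrightarrow> ?H"
    using half H_for for_sep sep_for for_H by metis
  have 2: "(\<forall>\<epsilon>. positive_null_seq \<epsilon> \<longrightarrow> ?sep \<epsilon>) \<longleftrightarrow> ?H"
    using half H_for for_sep sep_for for_H by metis
  have 3: "?for \<longleftrightarrow> ?H"
    using H_for for_H by metis
  have 4: "(\<exists>\<epsilon>. positive_null_seq \<epsilon> \<and> ?single \<epsilon>) \<longleftrightarrow> ?H" if "invertible_on X N (weighted_shift w)"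
    using half 1 sep_single single_sep[OF that] by metis
  have 5: "(\<forall>\<epsilon>. positive_null_seq \<epsilon> \<longrightarrow> ?single \<epsilon>) \<longleftrightarrow> ?H" if "invertible_on X N (weighted_shift w)"
    using half 2 4[OF that] sep_single by metis
  show ?thesis
    using 1 2 3 4 5 by (intro conjI impI)
qed

end
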